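(* Let $n\ge1$ be a fixed degree. For $\omega\in(0,(n+1)\pi)$ let $\mathrm{i}x_1(\omega),\ldots,\mathrm{i}x_{2n+1}(\omega)$ denote the interpolation nodes of the best approximation to $\mathrm{e}^{\omega z}$ in $\mathcal{U}_n$. For $\omega\to0^+$ the nodes $x_1(\omega),\ldots,x_{2n+1}(\omega)$ converge (up to ordering) to the $2n+1$ Chebyshev nodes $$\tau_j = \cos\left(\frac{(2j-1)\pi}{2(2n+1)}\right),\quad j=1,\ldots,2n+1.$$
   Context: For a complex polynomial $p$ let $p^\dag(z):=\overline{p}(-z)=\overline{p(-\overline z)}$, where $\overline p$ has complex-conjugated coefficients. Let $\mathcal{U}_n:=\{p^\dag/p : p \text{ a complex polynomial of degree}\le n,\ p\not\equiv 0\}$, with rational functions identified with their irreducible form; then $|r(\mathrm{i}x)|=1$ for $r\in\mathcal{U}_n$, $x\in\mathbb{R}$. For $r\in\mathcal{U}_n$, $\|r-\exp(\omega\cdot)\|:=\max_{x\in[-1,1]}|r(\mathrm{i}x)-\mathrm{e}^{\mathrm{i}\omega x}|$. For $\omega\in(0,(n+1)\pi)$ the best approximation $r_\omega$ to $\mathrm{e}^{\omega z}$ (on $z\in\mathrm{i}[-1,1]$) is the (existing and unique) element of $\mathcal{U}_n$ with $\|r_\omega-\exp(\omega\cdot)\|=\min_{u\in\mathcal{U}_n}\|u-\exp(\omega\cdot)\|$; this minimum is $<2$. Interpolation nodes: if $r\in\mathcal{U}_n$ (in irreducible form) has poles $s_j=\xi_j+\mathrm{i}\mu_j$, $j=1,\dots,m$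 (then $\xi_j\neq0$), and $\|r-\exp(\omega\cdot)\|<2$, then there is a unique function of the form $g(x)=\theta+2\sum_{j=1}^m\arctan\big(\frac{x-\mu_j}{\xi_j}\big)$, $\theta\in\mathbb{R}$, with $r(\mathrm{i}x)=\mathrm{e}^{\mathrm{i}g(x)}$ for $x\in\mathbb{R}$ and $\max_{x\in[-1,1]}|g(x)-\omega x|<\pi$. For the best approximation with $\omega\in(0,(n+1)\pi)$ the phase error $g(x)-\omega x$ has exactly $2n+1$ zeros $x_1(\omega)<\dots<x_{2n+1}(\omega)$ in $[-1,1]$, all simple; the points $\mathrm{i}x_j(\omega)$ are the interpolation nodes, and $r_\omega(\mathrm{i}x_j(\omega))=\mathrm{e}^{\mathrm{i}\omega x_j(\omega)}$. *)

theory Defs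
  imports Complex_Main "HOL-Computational_Algebra.Computational_Algebra"
    "HOL-Computational_Algebra.Field_as_Ring"
begin

definition dagger :: "complex poly \<Rightarrow> complex poly" where
  "dagger p = pcompose (map_poly cnj p) [:0, -1:]"

lemma poly_dagger: "poly (dagger p) z = cnj (poly p (- cnj z))"
proof -
  have "poly (map_poly cnj p) w = cnj (poly p (cnj w))" for w
    by (induction p) (simp_all add: map_poly_pCons)
  then show ?thesis
    by (simp add: dagger_def poly_pcompose)
qed

definition unitary_rat :: "nat \<Rightarrow> complex poly fract set" where
  "unitary_rat n = {Fract (dagger p) p | p. p \<noteq> 0 \<and> degree p \<le> n}"

(* Evaluation uses the irreducible form, so common zeros of dagger p and p (in particular every
   zero of p on the imaginary axis) do not matter; away from the poles of r this is the value
   of r. *)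
definition rat_eval :: "complex poly fract \<Rightarrow> complex \<Rightarrow> complex" where
  "rat_eval r z = poly (fst (quot_of_fract r)) z / poly (snd (quot_of_fract r)) z"

definition poles :: "complex poly fract \<Rightarrow> complex multiset" where
  "poles r = proots (snd (quot_of_fract r))"

(* For r in unitary_rat n the supremum is a maximum: r is continuous on the imaginary axis. *)
definition approx_error :: "real \<Rightarrow> complex poly fract \<Rightarrow> real" where
  "approx_error \<omega> r = (SUP x\<in>{-1..1}. cmod (rat_eval r (\<i> * of_real x) - exp (\<i> * of_real (\<omega> * x))))"

definition best_approx :: "nat \<Rightarrow> real \<Rightarrow> complex poly fract \<Rightarrow> bool" where
  "best_approx n \<omega> r \<longleftrightarrow> is_arg_min (approx_error \<omega>) (\<lambda>u. u \<in> unitary_rat n) r"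

(* Poles are counted with multiplicity. If approx_error \<omega> r < 2, there is exactly one such g. *)
definition phase_function :: "real \<Rightarrow> complex poly fract \<Rightarrow> (real \<Rightarrow> real) \<Rightarrow> bool" where
  "phase_function \<omega> r g \<longleftrightarrow>
     (\<exists>\<theta>. \<forall>x. g x = \<theta> + 2 * (\<Sum>s\<in>#poles r. arctan ((x - Im s) / Re s))) \<and>
     (\<forall>x. rat_eval r (\<i> * of_real x) = exp (\<i> * of_real (g x))) \<and>
     (\<forall>x\<in>{-1..1}. \<bar>g x - \<omega> * x\<bar> < pi)"

(* x 1 < ... < x (2 n + 1) are all the zeros of the phase error g x - \<omega> x in [-1, 1]. *)
definition interpolation_nodes ::
    "nat \<Rightarrow> real \<Rightarrow> complex poly fract \<Rightarrow> (nat \<Rightarrow> real) \<Rightarrow> bool" where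
  "interpolation_nodes n \<omega> r x \<longleftrightarrow>
     (\<exists>g. phase_function \<omega> r g \<and>
          strict_mono_on {1..2 * n + 1} x \<and>
          x ` {1..2 * n + 1} = {t \<in> {-1..1}. g t - \<omega> * t = 0})"

(* Decreasing in j, whereas interpolation nodes are listed increasingly. *)
definition chebyshev_node :: "nat \<Rightarrow> nat \<Rightarrow> real" where
  "chebyshev_node n j = cos ((2 * real j - 1) * pi / (2 * (2 * real n + 1)))"

end

theory Submission imports Defs begin

text \<open>
Write $t = \omega x$ and let $p(\mathrm{i}x) = P(\omega x)$. The error of $p^\dagger/p$ at $\mathrm{i}x$ has
modulus $2|F(\omega x)|/|P(\omega x)|$, where $F(t) = \mathrm{Im}(P(t) e^{\mathrm{i}t/2})$ is the residual of
$P$ (lemma \<open>error_eq_residual\<close>), and interpolation nodes are zeros of $F(\omega x)$. Polynomials $P$ of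
degree at most $n$ are described by the $2n+2$ real numbers $F^{(i)}(0)$, $i \le 2n+1$, the jets of
$P$: they determine $P$ with a bound on its size and can be prescribed arbitrarily
(\<open>cnorm_le_jets\<close>, \<open>ex_poly_with_jets\<close>).

For the best approximation $F$ has $2n+1$ zeros in $[-\omega,\omega]$. By Rolle's theorem its jets
of order at most $2n$ are $O(\omega)$ relative to the jet of order $2n+1$ (\<open>jets_of_interpolant\<close>).
After multiplication of $p$ by a real constant, $P$ is thus $O(\omega)$-close to a fixed
polynomial, the Pade denominator, which does not vanish at the origin. Hence $|P|$ is nearly the
same constant for all such polynomials, and Taylor's formula gives
$F(\omega x) = \omega^{2n+1} (M(x) + O(\omega))$ with a monic real polynomial $M$ of degree $2n+1$
that depends on $\omega$ (\<open>close_to_pade\<close>).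

Prescribing jets yields a competitor for which $M$ is the monic Chebyshev polynomial. Since it is
not better than the best approximation, the maximum norm of the latter's $M$ on $[-1,1]$
exceeds the minimal value $2^{-2n}$ only by $o(1)$. The extremal property of the Chebyshev
polynomial is stable (\<open>monic_near_minimal\<close>), so $F(\omega x)/\omega^{2n+1}$ converges uniformly
on $[-1,1]$ to the monic Chebyshev polynomial (\<open>best_residual_near_chebyshev\<close>). The latter
changes sign at each of its $2n+1$ zeros, so each of them has a zero of $F(\omega x)$ nearby, and
these exhaust the $2n+1$ interpolation nodes (\<open>nodes_near_chebyshev_nodes\<close>).
\<close>

section \<open>The coefficient norm of a polynomial\<close>

definition cnorm :: "complex poly \<Rightarrow> real" where
  "cnorm p = (\<Sum>i\<le>degree p. cmod (coeff p i))"

lemma cnorm_eq_sum: "degree p \<le> N \<Longrightarrow> cnorm p = (\<Sum>i\<le>N. cmod (coeff p i))"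
  unfolding cnorm_def
  by (rule sum.mono_neutral_left) (auto simp: coeff_eq_0 not_le)

lemma cnorm_nonneg [simp]: "0 \<le> cnorm p"
  by (simp add: cnorm_def sum_nonneg)

lemma cnorm_eq_0D: "cnorm p = 0 \<Longrightarrow> p = 0"
  unfolding cnorm_def
  by (subst (asm) sum_nonneg_eq_0_iff) (auto dest: bspec[of _ _ "degree p"])

lemma cnorm_add: "cnorm (p + q) \<le> cnorm p + cnorm q"
proof -
  define N where "N = max (degree p) (degree q)"
  have "cnorm (p + q) = (\<Sum>i\<le>N. cmod (coeff p i + coeff q i))"
    by (subst cnorm_eq_sum[of _ N]) (auto simp: N_def degree_add_le_max)
  also have "\<dots> \<le> (\<Sum>i\<le>N. cmod (coeff p i) + cmod (coeff q i))"
    by (intro sum_mono norm_triangle_ineq)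
  also have "\<dots> = cnorm p + cnorm q"
    by (simp add: sum.distrib cnorm_eq_sum[of p N] cnorm_eq_sum[of q N] N_def)
  finally show ?thesis .
qed

lemma cnorm_smult [simp]: "cnorm (smult c p) = cmod c * cnorm p"
  by (subst cnorm_eq_sum[of _ "degree p"])
    (auto simp: cnorm_def norm_mult sum_distrib_left)

lemma cnorm_uminus [simp]: "cnorm (- p) = cnorm p"
  by (simp add: cnorm_def)

lemma cnorm_pCons [simp]: "cnorm (pCons a p) = cmod a + cnorm p"
  by (subst cnorm_eq_sum[of _ "Suc (degree p)"])
    (auto simp: cnorm_def sum.atMost_Suc_shift degree_pCons_eq_if simp del: sum.atMost_Suc)

lemma cnorm_pderiv: "cnorm (pderiv p) \<le> degree p * cnorm p"
proof (cases "degree p")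
  case 0
  then show ?thesis by (simp add: cnorm_def pderiv_eq_0_iff[THEN iffD2])
next
  case (Suc d)
  have "cnorm (pderiv p) = (\<Sum>i\<le>d. cmod (coeff (pderiv p) i))"
    by (rule cnorm_eq_sum) (simp add: degree_pderiv Suc)
  also have "\<dots> = (\<Sum>i\<le>d. real (Suc i) * cmod (coeff p (Suc i)))"
    by (simp add: coeff_pderiv norm_mult flip: of_nat_Suc del: of_nat_Suc)
  also have "\<dots> \<le> (\<Sum>i\<le>d. real (degree p) * cmod (coeff p (Suc i)))"
    by (intro sum_mono mult_right_mono) (auto simp: Suc)
  also have "\<dots> \<le> real (degree p) * cnorm p"
    unfolding cnorm_def Suc sum.atMost_Suc_shift by (simp add: sum_distrib_left distrib_left)
  finally show ?thesis .
qed

lemma cmod_poly_le_cnorm: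
  assumes "cmod z \<le> 1"
  shows "cmod (poly p z) \<le> cnorm p"
proof -
  have "cmod (poly p z) \<le> (\<Sum>i\<le>degree p. cmod (coeff p i * z ^ i))"
    unfolding poly_altdef by (rule norm_sum)
  also have "\<dots> \<le> cnorm p"
    unfolding cnorm_def
    by (intro sum_mono) (simp add: norm_mult norm_power power_le_one assms mult_left_le)
  finally show ?thesis .
qed

lemma cmod_poly_diff_0_le:
  assumes "cmod z \<le> 1"
  shows "cmod (poly p z - poly p 0) \<le> cmod z * cnorm p"
proof (cases p)
  case (pCons a q)
  have "cmod (poly p z - poly p 0) = cmod z * cmod (poly q z)"
    by (simp add: pCons norm_mult)
  also have "\<dots> \<le> cmod z * cnorm p"
    using cmod_poly_le_cnorm[OF assms, of q]
    by (intro mult_left_mono) (auto simp: pCons intro: add_increasing)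
  finally show ?thesis .
qed

section \<open>Residuals on the imaginary axis and their jets\<close>

text \<open>Differentiation of $P(t) e^{\mathrm{i}t/2}$ with the exponential factor taken out. The derivative of
\<open>residual P\<close> below is thereby the residual of \<open>twist P\<close>, and all derivatives of residuals can be
computed inside the space of polynomials of bounded degree.\<close>
definition twist :: "complex poly \<Rightarrow> complex poly" where
  "twist P = pderiv P + smult (\<i> / 2) P"

text \<open>If $p(\mathrm{i}x) = P(\omega x)$, then on the imaginary axis
$p^\dagger/p - e^{\omega z} = (\overline{P} - P e^{\mathrm{i}\omega x})/P$, and taking the factor
$e^{\mathrm{i}\omega x/2}$ out of the numerator leaves $-2\mathrm{i}$ times \<open>residual P (\<omega> * x)\<close>.
So this real function carries the zeros and, up to $2/|P|$, the size of the approximation error.\<close>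
definition residual :: "complex poly \<Rightarrow> real \<Rightarrow> real" where
  "residual P t = Im (poly P (of_real t) * cis (t / 2))"

text \<open>The \<open>i\<close>-th derivative of \<open>residual P\<close> at the origin, expressed algebraically.\<close>
definition jet :: "nat \<Rightarrow> complex poly \<Rightarrow> real" where
  "jet i P = Im (poly ((twist ^^ i) P) 0)"

lemma twist_add: "twist (p + q) = twist p + twist q"
  by (simp add: twist_def pderiv_add smult_add_right)

lemma twist_smult: "twist (smult c p) = smult c (twist p)"
  by (simp add: twist_def pderiv_smult smult_add_right mult.commute)

lemma twist_pow_add: "(twist ^^ i) (p + q) = (twist ^^ i) p + (twist ^^ i) q"
  by (induction i) (simp_all add: twist_add)

lemma twist_pow_smult: "(twist ^^ i) (smult c p) = smult c ((twist ^^ i) p)"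
  by (induction i) (simp_all add: twist_smult)

lemma degree_twist_pow: "degree ((twist ^^ i) p) \<le> degree p"
proof (induction i)
  case (Suc i)
  have "degree (twist q) \<le> degree q" for q
    unfolding twist_def by (rule degree_add_le) (auto simp: degree_pderiv)
  then show ?case using Suc order_trans by simp blast
qed simp

lemma cnorm_twist_pow:
  assumes "degree p \<le> n"
  shows "cnorm ((twist ^^ i) p) \<le> (real n + 1) ^ i * cnorm p"
proof (induction i)
  case (Suc i)
  define q where "q = (twist ^^ i) p"
  have "degree q \<le> n"
    using degree_twist_pow[of i p] assms by (simp add: q_def)
  then have "real (degree q) * cnorm q \<le> real n * cnorm q"
    by (intro mult_right_mono) auto
  then have "cnorm (twist q) \<le> (real n + 1) * cnorm q"
    using cnorm_add[of "pderiv q" "smult (\<i> / 2) q"] cnorm_pderiv[of q] cnorm_nonneg[of q]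
    unfolding twist_def by (simp add: norm_divide algebra_simps del: cnorm_nonneg)
  also have "\<dots> \<le> (real n + 1) * ((real n + 1) ^ i * cnorm p)"
    using Suc by (intro mult_left_mono) (auto simp: q_def)
  finally show ?case by (simp add: q_def mult.assoc)
qed simp

lemma jet_add: "jet i (p + q) = jet i p + jet i q"
  by (simp add: jet_def twist_pow_add)

lemma jet_smult_of_real: "jet i (smult (of_real c) p) = c * jet i p"
  by (simp add: jet_def twist_pow_smult)

lemma jet_diff: "jet i (p - q) = jet i p - jet i q"
  using jet_add[of i p "smult (of_real (-1)) q"] jet_smult_of_real[of i "-1" q] by simp

lemma jet_0: "jet 0 P = Im (poly P 0)"
  by (simp add: jet_def)

lemma jet_1: "jet (Suc 0) P = Im (poly (pderiv P) 0) + Re (poly P 0) / 2"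
  by (simp add: jet_def twist_def)

text \<open>The operator $D^2 + 1/4$ annihilates $\sin(t/2)$ and $\cos(t/2)$. Applied to a residual it therefore
yields the residual of a polynomial whose degree is smaller by one; inductions on the degree
below run along this operator.\<close>
lemma jet_pderiv2:
  "jet i (pderiv (pderiv P) + smult \<i> (pderiv P)) = jet (Suc (Suc i)) P + jet i P / 4"
proof -
  have "pderiv (pderiv P) + smult \<i> (pderiv P) = twist (twist P) + smult (of_real (1/4)) P"
    by (rule poly_eqI) (simp add: twist_def pderiv_add pderiv_smult coeff_pderiv field_simps)
  moreover have "(twist ^^ i) (twist (twist P)) = (twist ^^ Suc (Suc i)) P"
    by (simp only: funpow_Suc_right o_apply)
  ultimately show ?thesis
    by (simp only: jet_add jet_smult_of_real) (simp add: jet_def)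
qed

text \<open>Leibniz' rule for the residual of $tP(t)$, which is $t$ times the residual of $P$.\<close>
lemma jet_pCons_0: "jet (Suc i) (pCons 0 P) = (real i + 1) * jet i P"
proof -
  have "(twist ^^ Suc i) (pCons 0 P) =
      pCons 0 ((twist ^^ Suc i) P) + smult (of_nat (Suc i)) ((twist ^^ i) P)"
  proof (induction i)
    case 0
    show ?case by (simp add: twist_def pderiv_pCons)
  next
    case (Suc i)
    have "twist (pCons 0 q) = pCons 0 (twist q) + q" for q
      by (simp add: twist_def pderiv_pCons)
    moreover have "smult (of_nat (Suc (Suc i))) q = q + smult (of_nat (Suc i)) q" for q :: "complex poly"
      by (rule poly_eqI) (simp add: algebra_simps)
    ultimately show ?case
      unfolding funpow.simps(2)[of "Suc i"] o_apply Suc twist_add twist_smult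
      by (simp add: add.assoc)
  qed
  then show ?thesis by (simp add: jet_def del: funpow.simps)
qed

lemma residual_0: "residual ((twist ^^ i) P) 0 = jet i P"
  by (simp add: residual_def jet_def)

lemma DERIV_residual: "(residual P has_real_derivative residual (twist P) t) (at t)"
proof -
  define f where "f = (\<lambda>z. poly P z * exp (\<i> * z / 2))"
  have "(f has_field_derivative
      (poly (twist P) (of_real t) * exp (\<i> * of_real t / 2))) (at (of_real t))"
    unfolding f_def
    by (auto intro!: derivative_eq_intros simp: twist_def algebra_simps)
  then have "(f has_derivative (\<lambda>h. (poly (twist P) (of_real t) * exp (\<i> * of_real t / 2)) * h))
      (at (of_real t))"
    by (simp add: has_field_derivative_def)
  from has_derivative_compose[OF bounded_linear.has_derivative[OF bounded_linear_of_real has_derivative_ident] this]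
  have "((\<lambda>t. Im (f (of_real t))) has_derivative
      (\<lambda>h. Im ((poly (twist P) (of_real t) * exp (\<i> * of_real t / 2)) * of_real h))) (at t)"
    by (intro bounded_linear.has_derivative[OF bounded_linear_Im])
  then show ?thesis
    unfolding has_field_derivative_def f_def residual_def cis_conv_exp
    by (auto simp: fun_eq_iff elim!: has_derivative_eq_rhs)
qed

lemma DERIV_residual_twist_pow:
  "(residual ((twist ^^ i) P) has_real_derivative residual ((twist ^^ Suc i) P) t) (at t)"
  using DERIV_residual[of "(twist ^^ i) P" t] by simp

lemma abs_residual_le: "\<bar>t\<bar> \<le> 1 \<Longrightarrow> \<bar>residual P t\<bar> \<le> cnorm P"
proof -
  assume t: "\<bar>t\<bar> \<le> 1"
  have "\<bar>residual P t\<bar> \<le> cmod (poly P (of_real t) * cis (t / 2))"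
    unfolding residual_def by (rule abs_Im_le_cmod)
  also have "\<dots> = cmod (poly P (of_real t))"
    by (simp add: norm_mult)
  also have "\<dots> \<le> cnorm P"
    using t by (intro cmod_poly_le_cnorm) simp
  finally show ?thesis .
qed

text \<open>The crude remainder bound suffices because the residual is evaluated only on an interval of length
proportional to the frequency, which tends to zero.\<close>
lemma residual_taylor:
  assumes "degree P \<le> n" "\<bar>t\<bar> \<le> 1"
  shows "\<bar>residual P t - (\<Sum>m<k. jet m P / fact m * t ^ m)\<bar> \<le> (real n + 1) ^ k * cnorm P * \<bar>t\<bar> ^ k"
proof -
  obtain s where s: "\<bar>s\<bar> \<le> \<bar>t\<bar>" "residual P t =
      (\<Sum>m<k. residual ((twist ^^ m) P) 0 / fact m * t ^ m)
        + residual ((twist ^^ k) P) s / fact k * t ^ k"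
    using Maclaurin_all_le[of "\<lambda>m. residual ((twist ^^ m) P)" "residual P" t k]
      DERIV_residual_twist_pow by auto
  have "\<bar>residual ((twist ^^ k) P) s / fact k\<bar> \<le> \<bar>residual ((twist ^^ k) P) s\<bar> / 1"
    unfolding abs_divide by (intro divide_left_mono) (auto simp: fact_ge_1)
  also have "\<dots> \<le> cnorm ((twist ^^ k) P)"
    using abs_residual_le[of s] s(1) assms(2) by simp
  also have "\<dots> \<le> (real n + 1) ^ k * cnorm P"
    by (rule cnorm_twist_pow[OF assms(1)])
  finally have "\<bar>residual ((twist ^^ k) P) s / fact k\<bar> * \<bar>t\<bar> ^ k \<le> (real n + 1) ^ k * cnorm P * \<bar>t\<bar> ^ k"
    by (intro mult_right_mono) auto
  moreover have "residual P t - (\<Sum>m<k. jet m P / fact m * t ^ m) =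
      residual ((twist ^^ k) P) s / fact k * t ^ k"
    using s(2) by (simp add: residual_0)
  ultimately show ?thesis by (simp add: abs_mult power_abs)
qed

section \<open>Jets as coordinates on polynomials of bounded degree\<close>

text \<open>On polynomials of bounded degree $D + \mathrm{i}$ is a nonzero constant plus a nilpotent operator,
hence injective with a bounded inverse.\<close>
lemma cnorm_le_pderiv_plus:
  "\<exists>C\<ge>0. \<forall>Q. degree Q \<le> m \<longrightarrow> cnorm Q \<le> C * cnorm (pderiv Q + smult \<i> Q)"
proof (induction m)
  case 0
  have "cnorm Q \<le> 1 * cnorm (pderiv Q + smult \<i> Q)" if "degree Q \<le> 0" for Q
    using that by (simp add: pderiv_eq_0_iff[THEN iffD2])
  then show ?case by (intro exI[of _ 1]) auto
next
  case (Suc m)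
  then obtain C where C: "C \<ge> 0"
    "\<And>Q. degree Q \<le> m \<Longrightarrow> cnorm Q \<le> C * cnorm (pderiv Q + smult \<i> Q)" by blast
  have "cnorm Q \<le> (1 + C * real (Suc m)) * cnorm (pderiv Q + smult \<i> Q)"
    if deg: "degree Q \<le> Suc m" for Q
  proof -
    define R where "R = pderiv Q + smult \<i> Q"
    have degR: "degree R \<le> Suc m"
      unfolding R_def using deg by (intro degree_add_le) (auto simp: degree_pderiv)
    have "Q = smult (- \<i>) R + smult \<i> (pderiv Q)"
      by (simp add: R_def smult_add_right flip: smult_add_left)
    then have Q: "cnorm Q \<le> cnorm R + cnorm (pderiv Q)"
      using cnorm_add[of "smult (- \<i>) R" "smult \<i> (pderiv Q)"] by simp
    have "cnorm (pderiv Q) \<le> C * cnorm (pderiv (pderiv Q) + smult \<i> (pderiv Q))"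
      using deg by (intro C(2)) (simp add: degree_pderiv)
    also have "pderiv (pderiv Q) + smult \<i> (pderiv Q) = pderiv R"
      by (simp add: R_def pderiv_add pderiv_smult)
    also have "C * cnorm (pderiv R) \<le> C * (real (Suc m) * cnorm R)"
      by (intro mult_left_mono[OF _ C(1)] order_trans[OF cnorm_pderiv] mult_right_mono)
        (use degR in auto)
    finally show ?thesis
      using Q by (simp add: R_def algebra_simps)
  qed
  then show ?case using C(1) by (intro exI[of _ "1 + C * real (Suc m)"]) auto
qed

lemma cnorm_le_pderiv: "cnorm P \<le> cmod (poly P 0) + cnorm (pderiv P)"
proof (cases P)
  case (pCons a q)
  have "cnorm q \<le> cnorm (pderiv P)"
  proof -
    have deg: "degree (pderiv P) \<le> degree q"
      unfolding degree_pderiv pCons by (simp add: degree_pCons_eq_if)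
    have "cnorm q = (\<Sum>i\<le>degree q. cmod (coeff q i))" by (simp add: cnorm_def)
    also have "\<dots> \<le> (\<Sum>i\<le>degree q. cmod (coeff (pderiv P) i))"
    proof (rule sum_mono)
      fix i
      have "1 * cmod (coeff q i) \<le> real (Suc i) * cmod (coeff q i)"
        by (intro mult_right_mono) auto
      then show "cmod (coeff q i) \<le> cmod (coeff (pderiv P) i)"
        by (simp add: pCons coeff_pderiv norm_mult del: of_nat_Suc)
    qed
    also have "\<dots> = cnorm (pderiv P)" by (rule cnorm_eq_sum[symmetric, OF deg])
    finally show ?thesis .
  qed
  then show ?thesis by (simp add: pCons)
qed

text \<open>Polynomials of degree at most \<open>m\<close> form a real space of dimension $2m+2$, and the first
$2m+2$ jets are coordinates on it. Quantitatively: the polynomial attached to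
$(D^2+1/4)$ of the residual has smaller degree and controlled jets, so it is controlled by
induction; undoing the operator leaves only the constant coefficient free, and its
imaginary and real parts are visible in the first two jets.\<close>
lemma cnorm_le_jets:
  "\<exists>C\<ge>0. \<forall>P. degree P \<le> m \<longrightarrow> cnorm P \<le> C * (\<Sum>i\<le>2*m+1. \<bar>jet i P\<bar>)"
proof (induction m)
  case 0
  have "cnorm P \<le> 2 * (\<Sum>i\<le>2*0+1. \<bar>jet i P\<bar>)" if "degree P \<le> 0" for P
  proof -
    have "pderiv P = 0" using that by (simp add: pderiv_eq_0_iff)
    then show ?thesis
      using cnorm_le_pderiv[of P] cmod_le[of "poly P 0"]
      by (simp add: jet_0 jet_1[simplified] cnorm_def)
  qed
  then show ?case by (intro exI[of _ 2]) auto
next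
  case (Suc m)
  then obtain C where C: "C \<ge> 0"
    "\<And>P. degree P \<le> m \<Longrightarrow> cnorm P \<le> C * (\<Sum>i\<le>2*m+1. \<bar>jet i P\<bar>)" by blast
  obtain B where B: "B \<ge> 0"
    "\<And>Q. degree Q \<le> m \<Longrightarrow> cnorm Q \<le> B * cnorm (pderiv Q + smult \<i> Q)"
    using cnorm_le_pderiv_plus[of m] by blast
  have "cnorm P \<le> (3 + 6 * B * C) * (\<Sum>i\<le>2*Suc m+1. \<bar>jet i P\<bar>)" if deg: "degree P \<le> Suc m" for P
  proof -
    define S where "S = (\<Sum>i\<le>2*Suc m+1. \<bar>jet i P\<bar>)"
    define R where "R = pderiv (pderiv P) + smult \<i> (pderiv P)"
    have le_S: "(\<Sum>i\<in>A. \<bar>jet i P\<bar>) \<le> S" if "A \<subseteq> {..2*Suc m+1}" for A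
      unfolding S_def using that by (intro sum_mono2) auto
    have degQ: "degree (pderiv P) \<le> m" using deg by (simp add: degree_pderiv)
    have degR: "degree R \<le> m"
      unfolding R_def using degQ by (intro degree_add_le) (auto simp: degree_pderiv)
    have "(\<Sum>i\<le>2*m+1. \<bar>jet i R\<bar>) \<le> (\<Sum>i\<le>2*m+1. \<bar>jet (Suc (Suc i)) P\<bar> + \<bar>jet i P\<bar>)"
      unfolding R_def jet_pderiv2 by (intro sum_mono) linarith
    also have "\<dots> = (\<Sum>i\<in>(Suc \<circ> Suc) ` {..2*m+1}. \<bar>jet i P\<bar>) + (\<Sum>i\<le>2*m+1. \<bar>jet i P\<bar>)"
      by (subst sum.reindex) (auto simp: sum.distrib inj_on_def)
    also have "\<dots> \<le> S + S" by (intro add_mono le_S) auto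
    finally have "C * (\<Sum>i\<le>2*m+1. \<bar>jet i R\<bar>) \<le> C * (2 * S)" using C(1) by (intro mult_left_mono) auto
    with C(2)[OF degR] have "B * cnorm R \<le> B * (C * (2 * S))"
      using B(1) by (intro mult_left_mono) auto
    with B(2)[OF degQ] have Q: "cnorm (pderiv P) \<le> 2 * (B * C * S)"
      by (simp add: R_def mult_ac)
    have "cmod (poly (pderiv P) 0) \<le> cnorm (pderiv P)" by (rule cmod_poly_le_cnorm) simp
    \<comment> \<open>In the jet of order one, half the real part of the constant coefficient is added to this term.\<close>
    then have "\<bar>Im (poly (pderiv P) 0)\<bar> \<le> cnorm (pderiv P)"
      using abs_Im_le_cmod order_trans by blast
    moreover have "\<bar>jet 0 P\<bar> + \<bar>jet (Suc 0) P\<bar> \<le> S"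
      using le_S[of "{0, Suc 0}"] by simp
    ultimately have "cmod (poly P 0) \<le> 2 * S + 2 * cnorm (pderiv P)"
      using cmod_le[of "poly P 0"] unfolding jet_0 jet_1 by linarith
    moreover have "0 \<le> S" by (simp add: S_def sum_nonneg)
    ultimately show ?thesis
      using cnorm_le_pderiv[of P] Q unfolding S_def[symmetric] by (simp add: algebra_simps)
  qed
  then show ?case using C(1) B(1) by (intro exI[of _ "3 + 6 * B * C"]) auto
qed

text \<open>Solving $Q' + \mathrm{i}Q = R$ by induction on the degree: if $Q_1$ solves the equation for $R'$, then
$Q = -\mathrm{i}(R - Q_1)$ solves it for $R$.\<close>
lemma ex_pderiv_plus:
  "degree R \<le> m \<Longrightarrow> \<exists>Q. degree Q \<le> m \<and> pderiv Q + smult \<i> Q = R"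
proof (induction m arbitrary: R)
  case 0
  then have "pderiv R = 0" by (simp add: pderiv_eq_0_iff)
  with 0 show ?case by (intro exI[of _ "smult (-\<i>) R"]) (simp add: pderiv_smult pderiv_minus)
next
  case (Suc m)
  obtain Q where Q: "degree Q \<le> m" "pderiv Q + smult \<i> Q = pderiv R"
    using Suc.IH[of "pderiv R"] Suc.prems by (metis degree_pderiv diff_Suc_1 diff_le_mono)
  have "degree (smult (-\<i>) (R - Q)) \<le> Suc m"
    using Suc.prems Q(1) by (auto intro!: degree_diff_le)
  moreover have "pderiv (smult (-\<i>) (R - Q)) + smult \<i> (smult (-\<i>) (R - Q)) = R"
  proof -
    have "pderiv (smult (-\<i>) (R - Q)) = smult (-\<i>) (pderiv R - pderiv Q)"
      by (simp only: pderiv_smult pderiv_diff)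
    also have "\<dots> = Q" by (simp flip: Q(2))
    finally show ?thesis by simp
  qed
  ultimately show ?case by blast
qed

lemma ex_antideriv:
  fixes Q :: "complex poly"
  shows "\<exists>P. pderiv P = Q \<and> degree P \<le> Suc (degree Q) \<and> poly P 0 = c"
proof -
  define q where "q = (\<Sum>k\<le>degree Q. monom (coeff Q k / of_nat (Suc k)) k)"
  have coeff_q: "coeff q k = coeff Q k / of_nat (Suc k)" for k
    by (cases "k \<le> degree Q") (auto simp: q_def coeff_sum coeff_eq_0)
  have "degree q \<le> degree Q"
    by (rule degree_le) (simp add: coeff_q coeff_eq_0)
  moreover have "pderiv (pCons c q) = Q"
    by (rule poly_eqI) (simp add: coeff_pderiv coeff_q del: of_nat_Suc)
  ultimately show ?thesis
    by (intro exI[of _ "pCons c q"]) (auto simp: degree_pCons_eq_if)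
qed

text \<open>The jets can be prescribed arbitrarily, which is what supplies a competitor to the best
approximation: its residual is given any desired Taylor polynomial of degree $2m+1$.\<close>
lemma ex_poly_with_jets: "\<exists>P. degree P \<le> m \<and> (\<forall>i\<le>2*m+1. jet i P = d i)"
proof (induction m arbitrary: d)
  case 0
  define c where "c = Complex (2 * d 1) (d 0)"
  have "jet i [:c:] = d i" if "i \<le> 2*0+1" for i
    using that by (cases i) (auto simp: jet_0 jet_1 c_def)
  then show ?case by (intro exI[of _ "[:c:]"]) simp
next
  case (Suc m)
  obtain R where R: "degree R \<le> m" "\<forall>i\<le>2*m+1. jet i R = d (Suc (Suc i)) + d i / 4"
    using Suc.IH[of "\<lambda>i. d (Suc (Suc i)) + d i / 4"] by blast
  obtain Q where Q: "degree Q \<le> m" "pderiv Q + smult \<i> Q = R"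
    using ex_pderiv_plus[OF R(1)] by blast
  obtain P where P: "pderiv P = Q" "degree P \<le> Suc (degree Q)"
    "poly P 0 = Complex (2 * (d 1 - Im (poly Q 0))) (d 0)"
    using ex_antideriv by blast
  have "jet i P = d i" if "i \<le> 2*Suc m+1" for i
    using that
  proof (induction i rule: less_induct)
    case (less i)
    consider "i = 0" | "i = Suc 0" | k where "i = Suc (Suc k)" by (metis not0_implies_Suc)
    then show ?case
    proof cases
      case (3 k)
      have "jet (Suc (Suc k)) P + jet k P / 4 = d (Suc (Suc k)) + d k / 4"
        using jet_pderiv2[of k P] R(2) less.prems 3 by (simp add: P(1) Q(2))
      moreover have "jet k P = d k" using less 3 by simp
      ultimately show ?thesis by (simp add: 3)
    qed (simp_all add: jet_0 jet_1 P)
  qed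
  then show ?case using P(2) Q(1) by (intro exI[of _ P]) auto
qed

text \<open>A Pade denominator does not vanish at the origin: otherwise a factor $t$ could be cancelled,
and the remaining polynomial of smaller degree would have too many vanishing jets.\<close>
lemma poly_0_nonzero_of_jets:
  assumes "degree P \<le> n" "\<And>i. i \<le> 2 * n \<Longrightarrow> jet i P = 0" "P \<noteq> 0"
  shows "poly P 0 \<noteq> 0"
proof
  assume P0: "poly P 0 = 0"
  obtain a R where P: "P = pCons a R" by (cases P)
  with P0 have a: "a = 0" by simp
  with P assms(3) have "R \<noteq> 0" by auto
  then obtain k where k: "n = Suc k" "degree R \<le> k"
    using assms(1) P by (cases n) (auto simp: degree_pCons_eq_if)
  have "jet i R = 0" if "i \<le> 2 * k + 1" for i
    using assms(2)[of "Suc i"] that k jet_pCons_0[of i R] by (auto simp: P a)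
  then have "(\<Sum>i\<le>2*k+1. \<bar>jet i R\<bar>) = 0" by simp
  then have "cnorm R \<le> 0" using cnorm_le_jets[of k] k(2) by (metis mult_zero_right)
  then have "R = 0" using cnorm_eq_0D[of R] cnorm_nonneg[of R] by linarith
  with \<open>R \<noteq> 0\<close> show False by simp
qed

section \<open>Residuals with many zeros near the origin\<close>

text \<open>One zero of each derivative is enough for locating its value at the origin, since the interval
will shrink to the origin.\<close>
lemma iterated_rolle:
  fixes f :: "nat \<Rightarrow> real \<Rightarrow> real"
  assumes "\<And>i t. (f i has_real_derivative f (Suc i) t) (at t)"
    and "\<And>i. i \<le> k \<Longrightarrow> z i \<in> {a..b} \<and> f m (z i) = 0"
    and "\<And>i. i < k \<Longrightarrow> z i < z (Suc i)"
  shows "\<exists>s\<in>{a..b}. f (m + k) s = 0"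
  using assms(2,3)
proof (induction k arbitrary: m z)
  case 0
  then show ?case by auto
next
  case (Suc k)
  have "\<exists>s. z i < s \<and> s < z (Suc i) \<and> f (Suc m) s = 0" if "i \<le> k" for i
  proof -
    have "z i < z (Suc i)" "f m (z i) = f m (z (Suc i))" using Suc.prems that by auto
    moreover have "continuous_on {z i..z (Suc i)} (f m)"
      using assms(1) by (meson DERIV_continuous_on has_field_derivative_at_within)
    ultimately obtain s where "z i < s" "s < z (Suc i)" "(\<lambda>h. f (Suc m) s * h) = (\<lambda>v. 0)"
      using Rolle_deriv[of "z i" "z (Suc i)" "f m" "\<lambda>s h. f (Suc m) s * h"] assms(1)
      by (auto simp: has_field_derivative_def)
    then show ?thesis by (metis mult_cancel_left1 zero_neq_one mult_eq_0_iff)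
  qed
  then obtain s where s: "\<And>i. i \<le> k \<Longrightarrow> z i < s i \<and> s i < z (Suc i) \<and> f (Suc m) (s i) = 0"
    by metis
  have "\<exists>t\<in>{a..b}. f (Suc m + k) t = 0"
  proof (rule Suc.IH)
    fix i assume "i \<le> k"
    then show "s i \<in> {a..b} \<and> f (Suc m) (s i) = 0"
      using s[of i] Suc.prems(1)[of i] Suc.prems(1)[of "Suc i"] by auto
  next
    fix i assume "i < k"
    then show "s i < s (Suc i)" using s[of i] s[of "Suc i"] by auto
  qed
  then show ?case by simp
qed

text \<open>By Rolle's theorem the derivatives of order at most $2n$ of a residual with $2n+1$ zeros in
$[-\omega,\omega]$ vanish somewhere in that interval, so their values at the origin are
$O(\omega)$ relative to the size of the polynomial. Since the jets of order at most $2n+1$ control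
the polynomial, the last of them must dominate all others.\<close>
lemma jets_of_interpolant:
  "\<exists>B \<delta>. 0 \<le> B \<and> 0 < \<delta> \<and> (\<forall>\<omega> P z. 0 < \<omega> \<longrightarrow> \<omega> < \<delta> \<longrightarrow> degree P \<le> n \<longrightarrow> P \<noteq> 0 \<longrightarrow>
     (\<forall>i\<le>2*n. z i \<in> {-\<omega>..\<omega>} \<and> residual P (z i) = 0) \<longrightarrow> (\<forall>i<2*n. z i < z (Suc i)) \<longrightarrow>
     jet (2*n+1) P \<noteq> 0 \<and> (\<Sum>i\<le>2*n. \<bar>jet i P\<bar>) \<le> B * \<omega> * \<bar>jet (2*n+1) P\<bar>)"
proof -
  obtain C where C: "C \<ge> 0"
    "\<And>P. degree P \<le> n \<Longrightarrow> cnorm P \<le> C * (\<Sum>i\<le>2*n+1. \<bar>jet i P\<bar>)"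
    using cnorm_le_jets[of n] by blast
  define A where "A = (\<Sum>i\<le>2*n. (real n + 1) ^ Suc i)"
  have A: "A \<ge> 0" by (simp add: A_def sum_nonneg)
  \<comment> \<open>Below this threshold the jets of order at most \<open>2 * n\<close> can be absorbed into the left-hand side.\<close>
  define \<delta> where "\<delta> = min 1 (1 / (2 * A * C + 1))"
  have "jet (2*n+1) P \<noteq> 0 \<and> (\<Sum>i\<le>2*n. \<bar>jet i P\<bar>) \<le> 2 * A * C * \<omega> * \<bar>jet (2*n+1) P\<bar>"
    if \<omega>: "0 < \<omega>" "\<omega> < \<delta>" and P: "degree P \<le> n" "P \<noteq> 0"
      and z: "\<forall>i\<le>2*n. z i \<in> {-\<omega>..\<omega>} \<and> residual P (z i) = 0" "\<forall>i<2*n. z i < z (Suc i)"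
    for \<omega> P and z :: "nat \<Rightarrow> real"
  proof -
    have "\<omega> < 1" "\<omega> < 1 / (2 * A * C + 1)" using \<omega> by (auto simp: \<delta>_def)
    moreover have "0 < 2 * A * C + 1" using A C(1) by (simp add: add_nonneg_pos)
    ultimately have "\<omega> * (2 * A * C + 1) < 1" by (simp only: pos_less_divide_eq)
    then have small: "A * C * \<omega> \<le> 1 / 2"
      using \<omega>(1) by (simp add: algebra_simps)
    define S where "S = (\<Sum>i\<le>2*n. \<bar>jet i P\<bar>)"
    have "\<bar>jet i P\<bar> \<le> (real n + 1) ^ Suc i * (\<omega> * cnorm P)" if i: "i \<le> 2 * n" for i
    proof -
      obtain s where s: "s \<in> {-\<omega>..\<omega>}" "residual ((twist ^^ (0 + i)) P) s = 0"
        using iterated_rolle[of "\<lambda>i. residual ((twist ^^ i) P)" i z "-\<omega>" \<omega> 0]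
          DERIV_residual_twist_pow z i by auto
      have "\<bar>residual ((twist ^^ i) P) s - (\<Sum>m<1. jet m ((twist ^^ i) P) / fact m * s ^ m)\<bar>
          \<le> (real n + 1) ^ 1 * cnorm ((twist ^^ i) P) * \<bar>s\<bar> ^ 1"
        using degree_twist_pow[of i P] P(1) s(1) \<open>\<omega> < 1\<close> by (intro residual_taylor) auto
      then have "\<bar>jet i P\<bar> \<le> (real n + 1) * cnorm ((twist ^^ i) P) * \<bar>s\<bar>"
        using s(2) by (simp add: jet_def)
      also have "\<dots> \<le> (real n + 1) * ((real n + 1) ^ i * cnorm P) * \<omega>"
        using cnorm_twist_pow[OF P(1)] s(1) by (intro mult_mono) auto
      finally show ?thesis by (simp add: mult_ac)
    qed
    then have "S \<le> (\<Sum>i\<le>2*n. (real n + 1) ^ Suc i * (\<omega> * cnorm P))"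
      unfolding S_def by (intro sum_mono) auto
    also have "\<dots> = A * \<omega> * cnorm P"
      by (simp add: A_def sum_distrib_right sum_distrib_left mult_ac)
    also have "\<dots> \<le> A * \<omega> * (C * (S + \<bar>jet (2*n+1) P\<bar>))"
      using C(2)[OF P(1)] A \<omega>(1) by (intro mult_left_mono) (auto simp: S_def)
    finally have S: "S \<le> (A * C * \<omega>) * S + A * C * \<omega> * \<bar>jet (2*n+1) P\<bar>"
      by (simp add: algebra_simps)
    have "0 \<le> S" by (simp add: S_def sum_nonneg)
    then have "(A * C * \<omega>) * S \<le> 1 / 2 * S" using small by (intro mult_right_mono)
    with S have S': "S \<le> 2 * A * C * \<omega> * \<bar>jet (2*n+1) P\<bar>" by simp
    have "jet (2*n+1) P \<noteq> 0"
    proof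
      assume "jet (2*n+1) P = 0"
      with S' \<open>0 \<le> S\<close> have "S = 0" "\<bar>jet (2*n+1) P\<bar> = 0" by auto
      then have "cnorm P \<le> C * 0" using C(2)[OF P(1)] by (simp add: S_def)
      then have "P = 0" using cnorm_eq_0D[of P] cnorm_nonneg[of P] by linarith
      with P(2) show False by simp
    qed
    with S' show ?thesis by (simp add: S_def)
  qed
  moreover have "0 < \<delta>" "0 \<le> 2 * A * C" using A C(1) by (auto simp: \<delta>_def add_nonneg_pos)
  ultimately show ?thesis by blast
qed

text \<open>After scaling the jet of order $2n+1$ to $(2n+1)!$, all admissible polynomials lie within
$O(\omega)$ of a single one, the $(n,n)$ Pade denominator of the exponential function. Hence on
$[-\omega,\omega]$ they all have modulus close to one positive constant \<open>b\<close>, and their residuals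
agree with their Taylor polynomials of degree $2n+1$ up to $O(\omega^{2n+2})$. The normalised
Taylor polynomial on the right is monic of degree $2n+1$.\<close>
lemma close_to_pade:
  "\<exists>b>0. \<forall>B. \<exists>C\<ge>0. \<forall>\<omega> P. 0 < \<omega> \<longrightarrow> \<omega> \<le> 1 \<longrightarrow> degree P \<le> n \<longrightarrow>
     jet (2*n+1) P = fact (2*n+1) \<longrightarrow> (\<Sum>i\<le>2*n. \<bar>jet i P\<bar>) \<le> B * \<omega> \<longrightarrow>
     (\<forall>x. \<bar>x\<bar> \<le> 1 \<longrightarrow> \<bar>cmod (poly P (of_real (\<omega> * x))) - b\<bar> \<le> C * \<omega> \<and>
        \<bar>residual P (\<omega> * x) / \<omega> ^ (2*n+1) -
          (\<Sum>i\<le>2*n+1. jet i P / fact i * (\<omega> * x) ^ i) / \<omega> ^ (2*n+1)\<bar> \<le> C * \<omega>)"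
proof -
  obtain K where K: "K \<ge> 0"
    "\<And>P. degree P \<le> n \<Longrightarrow> cnorm P \<le> K * (\<Sum>i\<le>2*n+1. \<bar>jet i P\<bar>)"
    using cnorm_le_jets[of n] by blast
  \<comment> \<open>The Pade denominator, recognised by the order $2n+1$ of contact at the origin.\<close>
  obtain P0 where P0: "degree P0 \<le> n"
    "\<And>i. i \<le> 2*n+1 \<Longrightarrow> jet i P0 = (if i = 2*n+1 then fact (2*n+1) else 0)"
    using ex_poly_with_jets[of n "\<lambda>i. if i = 2*n+1 then fact (2*n+1) else 0"] by auto
  have "jet (2*n+1) 0 = 0" using jet_smult_of_real[of "2*n+1" 0 0] by simp
  then have "P0 \<noteq> 0" using P0(2)[of "2*n+1"] by auto
  then have nz: "poly P0 0 \<noteq> 0"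
    using poly_0_nonzero_of_jets[of P0 n] P0 by auto
  define b where "b = cmod (poly P0 0)"
  have "\<exists>C\<ge>0. \<forall>\<omega> P. 0 < \<omega> \<longrightarrow> \<omega> \<le> 1 \<longrightarrow> degree P \<le> n \<longrightarrow>
     jet (2*n+1) P = fact (2*n+1) \<longrightarrow> (\<Sum>i\<le>2*n. \<bar>jet i P\<bar>) \<le> B * \<omega> \<longrightarrow>
     (\<forall>x. \<bar>x\<bar> \<le> 1 \<longrightarrow> \<bar>cmod (poly P (of_real (\<omega> * x))) - b\<bar> \<le> C * \<omega> \<and>
        \<bar>residual P (\<omega> * x) / \<omega> ^ (2*n+1) -
          (\<Sum>i\<le>2*n+1. jet i P / fact i * (\<omega> * x) ^ i) / \<omega> ^ (2*n+1)\<bar> \<le> C * \<omega>)" for B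
  proof -
    define D where "D = cnorm P0 + K * max 0 B"
    define C where "C = (real n + 1) ^ (2*n+2) * D + D + K * max 0 B"
    have D: "D \<ge> 0" using K(1) by (simp add: D_def)
    have "\<bar>cmod (poly P (of_real (\<omega> * x))) - b\<bar> \<le> C * \<omega> \<and>
        \<bar>residual P (\<omega> * x) / \<omega> ^ (2*n+1) -
          (\<Sum>i\<le>2*n+1. jet i P / fact i * (\<omega> * x) ^ i) / \<omega> ^ (2*n+1)\<bar> \<le> C * \<omega>"
      if \<omega>: "0 < \<omega>" "\<omega> \<le> 1" and P: "degree P \<le> n" "jet (2*n+1) P = fact (2*n+1)"
        "(\<Sum>i\<le>2*n. \<bar>jet i P\<bar>) \<le> B * \<omega>" and x: "\<bar>x\<bar> \<le> 1" for \<omega> P x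
    proof -
      have "(\<Sum>i\<le>2*n+1. \<bar>jet i (P - P0)\<bar>) = (\<Sum>i\<le>2*n. \<bar>jet i P\<bar>)"
        by (simp add: jet_diff P0(2) P(2)[simplified])
      also have "\<dots> \<le> max 0 B * \<omega>"
        by (rule order_trans[OF P(3)]) (use \<omega> in \<open>auto intro: mult_right_mono\<close>)
      finally have "K * (\<Sum>i\<le>2*n+1. \<bar>jet i (P - P0)\<bar>) \<le> K * (max 0 B * \<omega>)"
        using K(1) by (rule mult_left_mono)
      then have dist: "cnorm (P - P0) \<le> K * max 0 B * \<omega>"
        using K(2)[of "P - P0"] degree_diff_le[OF P(1) P0(1)] by simp
      also have "\<dots> \<le> K * max 0 B" using K(1) \<omega> by (intro mult_right_le_one_le) auto
      finally have PD: "cnorm P \<le> D"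
        using cnorm_add[of P0 "P - P0"] by (simp add: D_def)
      have absx: "\<bar>\<omega> * x\<bar> \<le> \<omega>" using \<omega>(1) x by (simp add: abs_mult mult_left_le)
      have "\<bar>cmod (poly P (of_real (\<omega> * x))) - b\<bar>
          \<le> cmod (poly P (of_real (\<omega> * x)) - poly P0 0)"
        unfolding b_def by (rule norm_triangle_ineq3)
      also have "\<dots> \<le> cmod (poly P (of_real (\<omega> * x)) - poly P 0) + cmod (poly (P - P0) 0)"
        by (rule order_trans[OF _ norm_triangle_ineq]) simp
      also have "\<dots> \<le> \<bar>\<omega> * x\<bar> * cnorm P + cnorm (P - P0)"
      proof (rule add_mono)
        have "\<bar>\<omega> * x\<bar> \<le> 1" using absx \<omega>(2) by linarith
        then show "cmod (poly P (of_real (\<omega> * x)) - poly P 0) \<le> \<bar>\<omega> * x\<bar> * cnorm P"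
          using cmod_poly_diff_0_le[of "of_real (\<omega> * x)" P] by (simp only: norm_of_real)
        show "cmod (poly (P - P0) 0) \<le> cnorm (P - P0)" by (rule cmod_poly_le_cnorm) simp
      qed
      also have "\<dots> \<le> \<omega> * D + K * max 0 B * \<omega>"
        using dist PD absx \<omega> by (intro add_mono mult_mono) auto
      also have "\<dots> \<le> C * \<omega>" using \<omega> D by (simp add: C_def algebra_simps)
      finally have 1: "\<bar>cmod (poly P (of_real (\<omega> * x))) - b\<bar> \<le> C * \<omega>" .
      have "\<bar>residual P (\<omega> * x) - (\<Sum>i<2*n+2. jet i P / fact i * (\<omega> * x) ^ i)\<bar>
          \<le> (real n + 1) ^ (2*n+2) * cnorm P * \<bar>\<omega> * x\<bar> ^ (2*n+2)"
        using absx \<omega> P(1) by (intro residual_taylor) auto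
      also have "\<dots> \<le> (real n + 1) ^ (2*n+2) * D * \<omega> ^ (2*n+2)"
        using PD absx D by (intro mult_mono power_mono) auto
      also have "\<dots> \<le> C * \<omega> ^ (2*n+2)"
        using D K(1) \<omega> by (intro mult_right_mono) (auto simp: C_def)
      finally have "\<bar>residual P (\<omega> * x) - (\<Sum>i\<le>2*n+1. jet i P / fact i * (\<omega> * x) ^ i)\<bar>
          / \<omega> ^ (2*n+1) \<le> C * \<omega> ^ (2*n+2) / \<omega> ^ (2*n+1)"
        using \<omega>(1) by (intro divide_right_mono) (auto simp: lessThan_Suc_atMost[symmetric])
      also have "\<dots> = C * \<omega>" using \<omega>(1) by simp
      finally have 2: "\<bar>residual P (\<omega> * x) / \<omega> ^ (2*n+1) -
          (\<Sum>i\<le>2*n+1. jet i P / fact i * (\<omega> * x) ^ i) / \<omega> ^ (2*n+1)\<bar> \<le> C * \<omega>"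
        using \<omega>(1) by (simp add: abs_divide power_abs flip: diff_divide_distrib)
      from 1 2 show ?thesis by blast
    qed
    moreover have "0 \<le> C" using D K(1) by (simp add: C_def)
    ultimately show ?thesis by blast
  qed
  then show ?thesis using nz by (intro exI[of _ b]) (auto simp: b_def)
qed

section \<open>Stability of the extremal property of Chebyshev polynomials\<close>

fun cheb :: "nat \<Rightarrow> real poly" where
  "cheb 0 = 1"
| "cheb (Suc 0) = [:0, 1:]"
| "cheb (Suc (Suc n)) = [:0, 2:] * cheb (Suc n) - cheb n"

lemma poly_cheb_cos: "poly (cheb n) (cos \<theta>) = cos (real n * \<theta>)"
proof (induction n rule: cheb.induct)
  case (3 n)
  have "cos (real (Suc n) * \<theta> + \<theta>) + cos (real (Suc n) * \<theta> - \<theta>)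
      = 2 * cos \<theta> * cos (real (Suc n) * \<theta>)"
    by (simp only: cos_add cos_diff) (simp add: algebra_simps)
  moreover have "real (Suc n) * \<theta> + \<theta> = real (Suc (Suc n)) * \<theta>" "real (Suc n) * \<theta> - \<theta> = real n * \<theta>"
    by (simp_all add: algebra_simps)
  ultimately have "cos (real (Suc (Suc n)) * \<theta>) = 2 * cos \<theta> * cos (real (Suc n) * \<theta>) - cos (real n * \<theta>)"
    by simp
  then show ?case by (simp only: cheb.simps poly_diff poly_mult 3) simp
qed simp_all

lemma degree_cheb_le: "degree (cheb n) \<le> n"
proof (induction n rule: cheb.induct)
  case (3 n)
  have "degree ([:0, 2:] * cheb (Suc n)) \<le> 1 + Suc n"
    by (rule order_trans[OF degree_mult_le]) (use 3 in simp)
  then show ?case using 3 by (auto intro!: degree_diff_le)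
qed simp_all

lemma coeff_cheb: "coeff (cheb (Suc n)) (Suc n) = 2 ^ n"
proof (induction n)
  case (Suc n)
  have "coeff (cheb n) (Suc (Suc n)) = 0"
    using degree_cheb_le[of n] by (intro coeff_eq_0) auto
  then show ?case using Suc by (simp add: coeff_pCons)
qed simp

definition monic_cheb :: "nat \<Rightarrow> real poly" where
  "monic_cheb N = smult (1 / 2 ^ (N - 1)) (cheb N)"

lemma degree_monic_cheb: "degree (monic_cheb N) \<le> N"
  by (simp add: monic_cheb_def degree_cheb_le)

lemma coeff_monic_cheb: "0 < N \<Longrightarrow> coeff (monic_cheb N) N = 1"
  by (cases N) (simp_all add: monic_cheb_def coeff_cheb)

lemma poly_monic_cheb_cos: "poly (monic_cheb N) (cos \<theta>) = cos (real N * \<theta>) / 2 ^ (N - 1)"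
  by (simp add: monic_cheb_def poly_cheb_cos)

lemma abs_poly_monic_cheb_le: "\<bar>x\<bar> \<le> 1 \<Longrightarrow> \<bar>poly (monic_cheb N) x\<bar> \<le> 1 / 2 ^ (N - 1)"
  using poly_monic_cheb_cos[of N "arccos x"] by (simp add: abs_divide divide_right_mono)

definition lagrange_basis :: "(nat \<Rightarrow> real) \<Rightarrow> nat \<Rightarrow> nat \<Rightarrow> real poly" where
  "lagrange_basis y N k = smult (1 / (\<Prod>l\<in>{..N} - {k}. y k - y l)) (\<Prod>l\<in>{..N} - {k}. [:- y l, 1:])"

lemma poly_lagrange_basis:
  assumes "inj_on y {..N}" "k \<le> N" "m \<le> N"
  shows "poly (lagrange_basis y N k) (y m) = (if m = k then 1 else 0)"
proof (cases "m = k")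
  case True
  then have "(\<Prod>l\<in>{..N} - {k}. y k - y l) \<noteq> 0"
    using assms by (auto simp: inj_on_def)
  then show ?thesis using True by (simp add: lagrange_basis_def poly_prod)
next
  case False
  then have "(\<Prod>l\<in>{..N} - {k}. y m - y l) = 0" using assms by auto
  then show ?thesis using False by (simp add: lagrange_basis_def poly_prod)
qed

lemma degree_lagrange_basis: "k \<le> N \<Longrightarrow> degree (lagrange_basis y N k) \<le> N"
  unfolding lagrange_basis_def
  by (rule order_trans[OF degree_smult_le order_trans[OF degree_prod_sum_le]]) simp_all

lemma coeff_lagrange_basis:
  assumes "k \<le> N"
  shows "coeff (lagrange_basis y N k) N = 1 / (\<Prod>l\<in>{..N} - {k}. y k - y l)"
proof -
  define p where "p = (\<Prod>l\<in>{..N} - {k}. [:- y l, 1:])"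
  have "lead_coeff p = 1" by (simp add: p_def lead_coeff_prod)
  moreover have "degree p = N"
    using assms by (simp add: p_def degree_prod_eq_sum_degree)
  ultimately show ?thesis by (simp add: lagrange_basis_def p_def[symmetric])
qed

lemma lagrange_interpolation:
  assumes "inj_on y {..N}" "degree p \<le> N"
  shows "p = (\<Sum>k\<le>N. smult (poly p (y k)) (lagrange_basis y N k))"
proof (rule poly_eqI_degree[of "y ` {..N}"])
  have "card (y ` {..N}) = Suc N" using assms(1) by (simp add: card_image)
  moreover have "degree (\<Sum>k\<le>N. smult (poly p (y k)) (lagrange_basis y N k)) \<le> N"
    by (intro degree_sum_le) (auto intro!: order_trans[OF degree_smult_le] degree_lagrange_basis)
  ultimately show "degree p < card (y ` {..N})"
    "degree (\<Sum>k\<le>N. smult (poly p (y k)) (lagrange_basis y N k)) < card (y ` {..N})"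
    using assms(2) by simp_all
next
  fix x assume "x \<in> y ` {..N}"
  then obtain m where m: "m \<le> N" "x = y m" by auto
  have "poly (\<Sum>k\<le>N. smult (poly p (y k)) (lagrange_basis y N k)) x
      = (\<Sum>k\<le>N. if k = m then poly p (y m) else 0)"
    unfolding poly_sum poly_smult m(2)
    by (intro sum.cong) (use assms(1) m(1) in \<open>auto simp: poly_lagrange_basis\<close>)
  then show "poly p x = poly (\<Sum>k\<le>N. smult (poly p (y k)) (lagrange_basis y N k)) x"
    using m by simp
qed

text \<open>The leading coefficient at the \<open>k\<close>-th point is the reciprocal of a product of differences, of
which exactly \<open>k\<close> are negative because the points are listed in decreasing order.\<close>
lemma sgn_coeff_lagrange_basis:
  assumes "\<And>i j. i < j \<Longrightarrow> j \<le> N \<Longrightarrow> y j < y i" "k \<le> N"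
  shows "0 < (-1) ^ k * coeff (lagrange_basis y N k) N"
proof -
  have "{..N} - {k} = {..<k} \<union> {k<..N}" using assms(2) by auto
  then have "(\<Prod>l\<in>{..N} - {k}. y k - y l) = (\<Prod>l<k. y k - y l) * (\<Prod>l\<in>{k<..N}. y k - y l)"
    by (simp add: prod.union_disjoint disjoint_iff)
  also have "(\<Prod>l<k. y k - y l) = (\<Prod>l<k. (-1) * (y l - y k))" by simp
  also have "\<dots> = (-1) ^ k * (\<Prod>l<k. y l - y k)"
    by (simp only: prod.distrib prod_constant card_lessThan)
  finally have "(-1) ^ k * (\<Prod>l\<in>{..N} - {k}. y k - y l)
      = (\<Prod>l<k. y l - y k) * (\<Prod>l\<in>{k<..N}. y k - y l)"
    by (simp flip: mult.assoc power_add mult_2)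
  moreover have "0 < (\<Prod>l<k. y l - y k)" "0 < (\<Prod>l\<in>{k<..N}. y k - y l)"
    using assms by (auto intro!: prod_pos)
  ultimately have "0 < (-1) ^ k * (\<Prod>l\<in>{..N} - {k}. y k - y l)" by simp
  then have "0 < 1 / ((-1) ^ k * (\<Prod>l\<in>{..N} - {k}. y k - y l))" by simp
  also have "\<dots> = (-1) ^ k * coeff (lagrange_basis y N k) N"
    unfolding coeff_lagrange_basis[OF assms(2)] by (cases "even k") simp_all
  finally show ?thesis .
qed

text \<open>A quantitative form of the argument that a polynomial of degree less than \<open>N\<close> cannot alternate in
sign at $N+1$ points: its divided difference over these points vanishes and is a combination of
the signed values with positive weights, so an upper bound for all signed values is also a
lower bound for each of them.\<close>
lemma poly_small_of_signed_bound:
  fixes y :: "nat \<Rightarrow> real"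
  assumes "\<And>i j. i < j \<Longrightarrow> j \<le> N \<Longrightarrow> y j < y i"
  shows "\<exists>C\<ge>0. \<forall>p \<epsilon>. 0 \<le> \<epsilon> \<longrightarrow> degree p < N \<longrightarrow> (\<forall>k\<le>N. (-1) ^ k * poly p (y k) \<le> \<epsilon>) \<longrightarrow>
    (\<forall>x. \<bar>x\<bar> \<le> 1 \<longrightarrow> \<bar>poly p x\<bar> \<le> C * \<epsilon>)"
proof -
  define w where "w k = (-1) ^ k * coeff (lagrange_basis y N k) N" for k
  define W where "W = (\<Sum>k\<le>N. w k)"
  have w: "0 < w k" if "k \<le> N" for k
    unfolding w_def using sgn_coeff_lagrange_basis[of N y k] assms that by blast
  have inj: "inj_on y {..N}"
    using assms by (intro inj_onI) (metis atMost_iff less_irrefl linorder_neqE_nat)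
  have "\<exists>B. \<forall>x\<in>{-1..1}. \<bar>poly (lagrange_basis y N k) x\<bar> \<le> B" for k
  proof -
    have "compact ((\<lambda>x. \<bar>poly (lagrange_basis y N k) x\<bar>) ` {-1..1})"
      by (intro compact_continuous_image continuous_intros compact_Icc)
    then show ?thesis using compact_attains_sup[of "(\<lambda>x. \<bar>poly (lagrange_basis y N k) x\<bar>) ` {-1..1}"]
      by (auto simp: image_iff)
  qed
  then obtain B where B: "\<And>k x. \<bar>x\<bar> \<le> 1 \<Longrightarrow> \<bar>poly (lagrange_basis y N k) x\<bar> \<le> B k"
    by (metis abs_le_iff atLeastAtMost_iff minus_le_iff)
  have B0: "0 \<le> B k" for k using B[of 0 k] by simp
  define C where "C = (\<Sum>k\<le>N. W / w k * B k)"
  have W: "0 \<le> W" unfolding W_def using w by (intro sum_nonneg) (auto intro: less_imp_le)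
  have "\<bar>poly p x\<bar> \<le> C * \<epsilon>"
    if \<epsilon>: "0 \<le> \<epsilon>" and p: "degree p < N" "\<And>k. k \<le> N \<Longrightarrow> (-1) ^ k * poly p (y k) \<le> \<epsilon>"
      and x: "\<bar>x\<bar> \<le> 1" for p \<epsilon> x
  proof -
    define v where "v k = (-1) ^ k * poly p (y k)" for k
    have p_eq: "p = (\<Sum>k\<le>N. smult (poly p (y k)) (lagrange_basis y N k))"
      using p(1) by (intro lagrange_interpolation inj) simp
    have sgn: "((-1) ^ k * a) * ((-1) ^ k * b) = a * b" for k and a b :: real
      by (cases "even k") auto
    have "0 = coeff p N" using p(1) by (simp add: coeff_eq_0)
    also have "\<dots> = (\<Sum>k\<le>N. poly p (y k) * coeff (lagrange_basis y N k) N)"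
      by (subst p_eq) (simp add: coeff_sum)
    also have "\<dots> = (\<Sum>k\<le>N. v k * w k)" by (simp add: v_def w_def sgn)
    finally have sum0: "(\<Sum>k\<le>N. v k * w k) = 0" by simp
    have "\<bar>poly p (y k)\<bar> \<le> W / w k * \<epsilon>" if k: "k \<le> N" for k
    proof -
      have "- (v k * w k) = (\<Sum>l\<in>{..N} - {k}. v l * w l)"
        using sum0 k by (simp add: sum_diff1)
      also have "\<dots> \<le> (\<Sum>l\<in>{..N} - {k}. \<epsilon> * w l)"
        using p(2) w by (intro sum_mono mult_right_mono) (auto simp: v_def intro: less_imp_le)
      also have "\<dots> \<le> (\<Sum>l\<le>N. \<epsilon> * w l)"
        using w \<epsilon> by (intro sum_mono2) (auto intro!: mult_nonneg_nonneg less_imp_le[OF w])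
      finally have "- (v k * w k) \<le> \<epsilon> * W" by (simp add: W_def sum_distrib_left)
      moreover have "v k * w k \<le> \<epsilon> * W"
      proof -
        have "w k \<le> W" unfolding W_def using k w by (intro member_le_sum) (auto intro: less_imp_le)
        then show ?thesis using p(2)[OF k] w[OF k] \<epsilon>
          by (intro order_trans[OF mult_right_mono mult_left_mono]) (auto simp: v_def)
      qed
      ultimately have "\<bar>v k * w k\<bar> \<le> \<epsilon> * W" by linarith
      then have "\<bar>v k\<bar> \<le> W / w k * \<epsilon>"
        using w[OF k] by (simp add: abs_mult field_simps)
      then show ?thesis by (simp add: v_def abs_mult power_abs)
    qed note bound = this
    have "\<bar>poly p x\<bar> = \<bar>\<Sum>k\<le>N. poly p (y k) * poly (lagrange_basis y N k) x\<bar>"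
      by (subst p_eq) (simp add: poly_sum)
    also have "\<dots> \<le> (\<Sum>k\<le>N. \<bar>poly p (y k)\<bar> * \<bar>poly (lagrange_basis y N k) x\<bar>)"
      by (rule order_trans[OF sum_abs]) (simp add: abs_mult)
    also have "\<dots> \<le> (\<Sum>k\<le>N. (W / w k * \<epsilon>) * B k)"
      using bound B[OF x] B0 W w \<epsilon>
      by (intro sum_mono mult_mono) (auto intro!: mult_nonneg_nonneg divide_nonneg_nonneg less_imp_le[OF w])
    also have "\<dots> = C * \<epsilon>" by (simp add: C_def sum_distrib_left sum_distrib_right mult_ac)
    finally show ?thesis .
  qed
  moreover have "0 \<le> C"
    unfolding C_def using W w B0
    by (intro sum_nonneg mult_nonneg_nonneg divide_nonneg_nonneg) (auto intro: less_imp_le)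
  ultimately show ?thesis by blast
qed

text \<open>Stability of the minimality of the Chebyshev polynomial: if a monic polynomial has nearly minimal
norm, its difference to the Chebyshev polynomial has lower degree and is nearly signed at the $N+1$
extremal points, hence small.\<close>
lemma monic_near_minimal:
  assumes N: "0 < N"
  shows "\<exists>C\<ge>0. \<forall>M \<epsilon>. 0 \<le> \<epsilon> \<longrightarrow> degree M \<le> N \<longrightarrow> coeff M N = 1 \<longrightarrow>
    (\<forall>x. \<bar>x\<bar> \<le> 1 \<longrightarrow> \<bar>poly M x\<bar> \<le> 1 / 2 ^ (N - 1) + \<epsilon>) \<longrightarrow>
    (\<forall>x. \<bar>x\<bar> \<le> 1 \<longrightarrow> \<bar>poly M x - poly (monic_cheb N) x\<bar> \<le> C * \<epsilon>)"
proof -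
  \<comment> \<open>The extremal points of the Chebyshev polynomial.\<close>
  define y where "y k = cos (real k * pi / real N)" for k
  have "y j < y i" if "i < j" "j \<le> N" for i j
    unfolding y_def using that N
    by (intro cos_monotone_0_pi) (auto simp: field_simps)
  then obtain C where C: "0 \<le> C" "\<And>p \<epsilon>. 0 \<le> \<epsilon> \<Longrightarrow> degree p < N \<Longrightarrow>
      (\<forall>k\<le>N. (-1) ^ k * poly p (y k) \<le> \<epsilon>) \<Longrightarrow> (\<forall>x. \<bar>x\<bar> \<le> 1 \<longrightarrow> \<bar>poly p x\<bar> \<le> C * \<epsilon>)"
    using poly_small_of_signed_bound[of N y] by blast
  have "\<forall>x. \<bar>x\<bar> \<le> 1 \<longrightarrow> \<bar>poly (M - monic_cheb N) x\<bar> \<le> C * \<epsilon>"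
    if "0 \<le> \<epsilon>" and M: "degree M \<le> N" "coeff M N = 1"
      "\<And>x. \<bar>x\<bar> \<le> 1 \<Longrightarrow> \<bar>poly M x\<bar> \<le> 1 / 2 ^ (N - 1) + \<epsilon>" for M \<epsilon>
  proof (rule C(2)[OF \<open>0 \<le> \<epsilon>\<close>])
    have "coeff (M - monic_cheb N) N = 0" using M(2) coeff_monic_cheb[OF N] by simp
    moreover have "degree (M - monic_cheb N) \<le> N" using M(1) degree_monic_cheb by (rule degree_diff_le)
    ultimately show "degree (M - monic_cheb N) < N"
      using N by (metis leading_coeff_0_iff degree_0 le_neq_implies_less)
    show "\<forall>k\<le>N. (-1) ^ k * poly (M - monic_cheb N) (y k) \<le> \<epsilon>"
    proof (intro allI impI)
      fix k assume "k \<le> N"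
      have "poly (monic_cheb N) (y k) = (-1) ^ k / 2 ^ (N - 1)"
        using N by (simp add: y_def poly_monic_cheb_cos cos_npi)
      moreover have "(-1) ^ k * poly M (y k) \<le> \<bar>poly M (y k)\<bar>"
        by (cases "even k") auto
      moreover have "\<bar>y k\<bar> \<le> 1" by (simp add: y_def)
      ultimately show "(-1) ^ k * poly (M - monic_cheb N) (y k) \<le> \<epsilon>"
        using M(3)[of "y k"] by (simp add: right_diff_distrib flip: power_add mult_2)
    qed
  qed
  then show ?thesis using C(1) by (intro exI[of _ C]) auto
qed

section \<open>The error of a unitary rational function\<close>

text \<open>Coprimality of the reduced fraction ensures that its denominator vanishes only where the original
denominator does.\<close>
lemma rat_eval_Fract:
  assumes "poly p z \<noteq> 0"
  shows "rat_eval (Fract a p) z = poly a z / poly p z"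
proof -
  define c d where "c = fst (quot_of_fract (Fract a p))" and "d = snd (quot_of_fract (Fract a p))"
  have p: "p \<noteq> 0" using assms by auto
  have d: "d \<noteq> 0" by (simp add: d_def)
  have "Fract c d = Fract a p" by (simp add: c_def d_def)
  then have "c * p = a * d" using p d by (simp add: eq_fract)
  then have eq: "poly c z * poly p z = poly a z * poly d z" by (metis poly_mult)
  have "coprime c d" by (simp add: c_def d_def coprime_quot_of_fract)
  then obtain u v where "u * c + v * d = 1" using bezout_coefficients_fst_snd[of c d] by auto
  then have "poly u z * poly c z + poly v z * poly d z = 1"
    by (metis poly_1 poly_add poly_mult)
  with eq assms have "poly d z \<noteq> 0" by auto
  with eq assms show ?thesis
    by (simp add: rat_eval_def c_def[symmetric] d_def[symmetric] field_simps)
qed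

lemma exp_i_of_real: "exp (\<i> * of_real t) = cis t"
  by (simp add: cis_conv_exp)

text \<open>The real factor \<open>c\<close> expresses that multiplying the denominator by a real number does not change
the unitary function.\<close>
lemma error_eq_residual:
  assumes "c \<noteq> 0" "poly P (of_real (\<omega> * x)) = of_real c * poly p (\<i> * of_real x)"
    and "poly P (of_real (\<omega> * x)) \<noteq> 0"
  shows "cmod (rat_eval (Fract (dagger p) p) (\<i> * of_real x) - exp (\<i> * of_real (\<omega> * x)))
    = 2 * \<bar>residual P (\<omega> * x)\<bar> / cmod (poly P (of_real (\<omega> * x)))"
proof -
  define q where "q = poly p (\<i> * of_real x)"
  define e where "e = cis (\<omega> * x / 2)"
  have q: "q \<noteq> 0" using assms by (auto simp: q_def)
  have e: "e * cnj e = 1" "cmod e = 1" "exp (\<i> * of_real (\<omega> * x)) = e * e"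
    by (simp_all add: e_def cis_mult cis_cnj exp_i_of_real del: of_real_mult)
  have "cnj q / q - e * e = e * (cnj (q * e) - q * e) / q"
    using q e(1) by (simp add: field_simps)
  also have "cnj (q * e) - q * e = - (of_real (2 * Im (q * e)) * \<i>)"
    by (simp add: complex_eq_iff)
  finally have "cmod (cnj q / q - e * e) = cmod (e * - (of_real (2 * Im (q * e)) * \<i>) / q)"
    by (rule arg_cong)
  also have "\<dots> = 2 * \<bar>Im (q * e)\<bar> / cmod q"
    unfolding norm_divide norm_mult norm_minus_cancel norm_of_real e(2) by (simp only: abs_mult) simp
  finally have err: "cmod (cnj q / q - e * e) = 2 * \<bar>Im (q * e)\<bar> / cmod q" .
  have "rat_eval (Fract (dagger p) p) (\<i> * of_real x) = cnj q / q"
    using q by (simp add: rat_eval_Fract q_def poly_dagger)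
  then have "cmod (rat_eval (Fract (dagger p) p) (\<i> * of_real x) - exp (\<i> * of_real (\<omega> * x)))
      = 2 * \<bar>Im (q * e)\<bar> / cmod q"
    by (simp only: e(3) err)
  also have "\<dots> = 2 * (\<bar>c\<bar> * \<bar>Im (q * e)\<bar>) / (\<bar>c\<bar> * cmod q)"
    using assms(1) by (simp del: times_complex.sel)
  also have "\<bar>c\<bar> * cmod q = cmod (poly P (of_real (\<omega> * x)))"
    by (simp only: assms(2) q_def norm_mult norm_of_real)
  also have "\<bar>c\<bar> * \<bar>Im (q * e)\<bar> = \<bar>residual P (\<omega> * x)\<bar>"
  proof -
    have "residual P (\<omega> * x) = Im (of_real c * (q * e))"
      by (simp only: residual_def assms(2) q_def e_def mult.assoc)
    also have "\<dots> = c * Im (q * e)"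
      by (cases "q * e") (simp add: complex_of_real_mult_Complex)
    finally show ?thesis by (simp only: abs_mult)
  qed
  finally show ?thesis .
qed

lemma residual_eq_0:
  assumes "poly P (of_real t) = 0" shows "residual P t = 0"
  using assms by (simp add: residual_def)

text \<open>The phase error is less than $\pi$ in modulus, so it vanishes as soon as it is a multiple of $2\pi$.\<close>
lemma phase_function_node_iff:
  assumes "phase_function \<omega> r g" "t \<in> {-1..1}"
  shows "g t - \<omega> * t = 0 \<longleftrightarrow> rat_eval r (\<i> * of_real t) = exp (\<i> * of_real (\<omega> * t))"
proof
  assume "g t - \<omega> * t = 0"
  then show "rat_eval r (\<i> * of_real t) = exp (\<i> * of_real (\<omega> * t))"
    using assms by (auto simp: phase_function_def)
next
  assume "rat_eval r (\<i> * of_real t) = exp (\<i> * of_real (\<omega> * t))"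
  then have "cis (g t) = cis (\<omega> * t)"
    using assms by (simp add: phase_function_def cis_conv_exp)
  then have "cis (g t - \<omega> * t) = 1" by (simp flip: cis_divide)
  then have "cos (g t - \<omega> * t) = 1" by (metis cis.sel(1) one_complex.sel(1))
  then obtain k :: int where k: "g t - \<omega> * t = of_int k * 2 * pi"
    using cos_one_2pi_int by blast
  moreover have "\<bar>g t - \<omega> * t\<bar> < pi" using assms by (auto simp: phase_function_def)
  ultimately have "\<bar>of_int k * 2\<bar> * pi < 1 * pi" by (simp add: abs_mult)
  then have "\<bar>of_int k * 2 :: real\<bar> < 1" using pi_gt_zero by (simp only: mult_less_cancel_right_pos)
  then have "k = 0" by linarith
  with k show "g t - \<omega> * t = 0" by simp
qed

lemma error_le_approx_error:
  assumes "phase_function \<omega> r g" "\<bar>x\<bar> \<le> 1"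
  shows "cmod (rat_eval r (\<i> * of_real x) - exp (\<i> * of_real (\<omega> * x))) \<le> approx_error \<omega> r"
  unfolding approx_error_def
proof (rule cSUP_upper)
  have "cmod (rat_eval r (\<i> * of_real y) - exp (\<i> * of_real (\<omega> * y))) \<le> 2" for y
  proof -
    have "rat_eval r (\<i> * of_real y) = cis (g y)"
      using assms(1) by (simp add: phase_function_def cis_conv_exp)
    then show ?thesis
      using norm_triangle_ineq4[of "cis (g y)" "cis (\<omega> * y)"]
      by (simp add: exp_i_of_real del: of_real_mult)
  qed
  then show "bdd_above ((\<lambda>x. cmod (rat_eval r (\<i> * of_real x) - exp (\<i> * of_real (\<omega> * x)))) ` {-1..1})"
    by (intro bdd_aboveI2)
qed (use assms(2) in auto)

text \<open>Rescaling a Taylor polynomial from $[-\omega,\omega]$ to $[-1,1]$ and dividing by its leading term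
puts it among the monic polynomials, where the Chebyshev polynomial has minimal norm.\<close>
lemma sum_jets_eq_monic_poly:
  fixes a :: "nat \<Rightarrow> real"
  assumes "a N = fact N" "\<omega> \<noteq> 0"
  shows "\<exists>M. degree M \<le> N \<and> coeff M N = 1 \<and>
    (\<forall>x. poly M x = (\<Sum>i\<le>N. a i / fact i * (\<omega> * x) ^ i) / \<omega> ^ N)"
proof -
  define M where "M = (\<Sum>i\<le>N. monom (a i / fact i * \<omega> ^ i / \<omega> ^ N) i)"
  have "coeff M k = (if k \<le> N then a k / fact k * \<omega> ^ k / \<omega> ^ N else 0)" for k
    by (simp add: M_def coeff_sum)
  moreover have "poly M x = (\<Sum>i\<le>N. a i / fact i * (\<omega> * x) ^ i) / \<omega> ^ N" for x
    by (simp add: M_def poly_sum poly_monom sum_divide_distrib power_mult_distrib mult_ac)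
  ultimately show ?thesis using assms
    by (intro exI[of _ M]) (auto intro!: degree_le)
qed

section \<open>Comparison of the best approximation with the Chebyshev competitor\<close>

text \<open>The denominator of a function with $2n+1$ interpolation nodes, transported to the variable
$t = \omega x$ and scaled by a real factor so that its jet of order $2n+1$ is $(2n+1)!$.\<close>
lemma normalized_interpolant:
  "\<exists>B \<delta>. 0 \<le> B \<and> 0 < \<delta> \<and> (\<forall>\<omega> p x. 0 < \<omega> \<longrightarrow> \<omega> < \<delta> \<longrightarrow> p \<noteq> 0 \<longrightarrow> degree p \<le> n \<longrightarrow>
     interpolation_nodes n \<omega> (Fract (dagger p) p) x \<longrightarrow>
     (\<exists>c P. c \<noteq> 0 \<and> degree P \<le> n \<and> (\<forall>x. poly P (of_real (\<omega> * x)) = of_real c * poly p (\<i> * of_real x)) \<and>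
       jet (2*n+1) P = fact (2*n+1) \<and> (\<Sum>i\<le>2*n. \<bar>jet i P\<bar>) \<le> B * \<omega>))"
proof -
  obtain B \<delta> where B: "0 \<le> B" "0 < \<delta>" "\<And>\<omega> P z. \<lbrakk>0 < \<omega>; \<omega> < \<delta>; degree P \<le> n; P \<noteq> 0;
     \<forall>i\<le>2*n. z i \<in> {-\<omega>..\<omega>} \<and> residual P (z i) = 0; \<forall>i<2*n. z i < z (Suc i)\<rbrakk> \<Longrightarrow>
     jet (2*n+1) P \<noteq> 0 \<and> (\<Sum>i\<le>2*n. \<bar>jet i P\<bar>) \<le> B * \<omega> * \<bar>jet (2*n+1) P\<bar>"
    using jets_of_interpolant[of n] by blast
  have "\<exists>c P. c \<noteq> 0 \<and> degree P \<le> n \<and> (\<forall>x. poly P (of_real (\<omega> * x)) = of_real c * poly p (\<i> * of_real x)) \<and>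
       jet (2*n+1) P = fact (2*n+1) \<and> (\<Sum>i\<le>2*n. \<bar>jet i P\<bar>) \<le> B * fact (2*n+1) * \<omega>"
    if \<omega>: "0 < \<omega>" "\<omega> < \<delta>" and p: "p \<noteq> 0" "degree p \<le> n"
      and x: "interpolation_nodes n \<omega> (Fract (dagger p) p) x" for \<omega> p x
  proof -
    define Q where "Q = pcompose p [:0, \<i> / of_real \<omega>:]"
    have Q: "poly Q (of_real (\<omega> * t)) = poly p (\<i> * of_real t)" for t
      using \<omega>(1) by (simp add: Q_def poly_pcompose mult.commute)
    have "Q \<noteq> 0" "degree Q \<le> n"
      using p \<omega>(1) by (simp_all add: Q_def pcompose_eq_0_iff degree_pcompose)
    obtain g where g: "phase_function \<omega> (Fract (dagger p) p) g" "strict_mono_on {1..2*n+1} x"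
      "x ` {1..2*n+1} = {t \<in> {-1..1}. g t - \<omega> * t = 0}"
      using x by (auto simp: interpolation_nodes_def)
    have node: "residual Q (\<omega> * t) = 0" if "t \<in> x ` {1..2*n+1}" for t
    proof (cases "poly Q (of_real (\<omega> * t)) = 0")
      case False
      have "t \<in> {-1..1}" "g t - \<omega> * t = 0" using that g(3) by auto
      then have "rat_eval (Fract (dagger p) p) (\<i> * of_real t) = exp (\<i> * of_real (\<omega> * t))"
        using phase_function_node_iff[OF g(1)] by blast
      then show ?thesis
        using error_eq_residual[of 1 Q \<omega> t p] False by (simp add: Q[simplified])
    qed (rule residual_eq_0)
    have "jet (2*n+1) Q \<noteq> 0 \<and> (\<Sum>i\<le>2*n. \<bar>jet i Q\<bar>) \<le> B * \<omega> * \<bar>jet (2*n+1) Q\<bar>"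
    proof (rule B(3)[OF \<omega> \<open>degree Q \<le> n\<close> \<open>Q \<noteq> 0\<close>, of "\<lambda>i. \<omega> * x (Suc i)"]; intro allI impI)
      fix i assume i: "i \<le> 2 * n"
      then have "x (Suc i) \<in> x ` {1..2*n+1}" by auto
      then have "\<bar>x (Suc i)\<bar> \<le> 1" "residual Q (\<omega> * x (Suc i)) = 0"
        using g(3) node by auto
      moreover from this(1) have "\<bar>\<omega> * x (Suc i)\<bar> \<le> \<omega>"
        using \<omega>(1) by (simp add: abs_mult mult_left_le)
      ultimately show "\<omega> * x (Suc i) \<in> {-\<omega>..\<omega>} \<and> residual Q (\<omega> * x (Suc i)) = 0" by auto
    next
      fix i assume "i < 2 * n"
      then show "\<omega> * x (Suc i) < \<omega> * x (Suc (Suc i))"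
        using \<omega>(1) strict_mono_onD[OF g(2), of "Suc i" "Suc (Suc i)"] by auto
    qed
    then have J: "jet (2*n+1) Q \<noteq> 0" "(\<Sum>i\<le>2*n. \<bar>jet i Q\<bar>) \<le> B * \<omega> * \<bar>jet (2*n+1) Q\<bar>" by auto
    define c where "c = fact (2*n+1) / jet (2*n+1) Q"
    define P where "P = smult (of_real c) Q"
    have "(\<Sum>i\<le>2*n. \<bar>jet i P\<bar>) = \<bar>c\<bar> * (\<Sum>i\<le>2*n. \<bar>jet i Q\<bar>)"
      by (simp add: P_def jet_smult_of_real abs_mult sum_distrib_left)
    also have "\<dots> \<le> \<bar>c\<bar> * (B * \<omega> * \<bar>jet (2*n+1) Q\<bar>)"
      using J(2) by (intro mult_left_mono) auto
    also have "\<dots> = B * fact (2*n+1) * \<omega>"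
      using J(1) by (simp add: c_def abs_divide)
    finally have "(\<Sum>i\<le>2*n. \<bar>jet i P\<bar>) \<le> B * fact (2*n+1) * \<omega>" .
    moreover have "jet (2*n+1) P = fact (2*n+1)"
      unfolding P_def jet_smult_of_real c_def using J(1) by simp
    moreover have "poly P (of_real (\<omega> * t)) = of_real c * poly p (\<i> * of_real t)" for t
      by (simp only: P_def poly_smult Q)
    moreover have "c \<noteq> 0" using J(1) by (simp add: c_def)
    moreover have "degree P \<le> n" using \<open>degree Q \<le> n\<close> \<open>c \<noteq> 0\<close> by (simp add: P_def)
    ultimately show ?thesis by blast
  qed
  moreover have "0 \<le> B * fact (2*n+1)" using B(1) by simp
  ultimately show ?thesis using B(2) by blast
qed

text \<open>The residuals of the best approximation and of a competitor whose residual has the Chebyshev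
polynomial as its normalised Taylor polynomial have denominators of nearly the same modulus. So
optimality says that the monic polynomial of the best approximation has norm at most
$2^{-2n} + o(1)$, and stability makes it converge to the Chebyshev polynomial.\<close>
lemma best_residual_near_chebyshev:
  assumes \<epsilon>: "0 < \<epsilon>"
  shows "\<forall>\<^sub>F \<omega> in at_right 0. \<forall>r x. best_approx n \<omega> r \<longrightarrow> interpolation_nodes n \<omega> r x \<longrightarrow>
    (\<exists>P. \<forall>t. \<bar>t\<bar> \<le> 1 \<longrightarrow> (residual P (\<omega> * t) = 0 \<longrightarrow> t \<in> x ` {1..2*n+1}) \<and>
      \<bar>residual P (\<omega> * t) / \<omega> ^ (2*n+1) - poly (monic_cheb (2*n+1)) t\<bar> < \<epsilon>)"
proof -
  define N where "N = 2 * n + 1"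
  define \<mu> :: real where "\<mu> = 1 / 2 ^ (N - 1)"
  define T where "T = monic_cheb N"
  have \<mu>: "0 < \<mu>" by (simp add: \<mu>_def)
  obtain B1 \<delta> where B1: "0 \<le> B1" "0 < \<delta>" "\<And>\<omega> p x. \<lbrakk>0 < \<omega>; \<omega> < \<delta>; p \<noteq> 0; degree p \<le> n;
     interpolation_nodes n \<omega> (Fract (dagger p) p) x\<rbrakk> \<Longrightarrow>
     (\<exists>c P. c \<noteq> 0 \<and> degree P \<le> n \<and> (\<forall>x. poly P (of_real (\<omega> * x)) = of_real c * poly p (\<i> * of_real x)) \<and>
       jet N P = fact N \<and> (\<Sum>i\<le>2*n. \<bar>jet i P\<bar>) \<le> B1 * \<omega>)"
    using normalized_interpolant[of n] unfolding N_def by blast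
  define B2 where "B2 = (\<Sum>i\<le>2*n. \<bar>coeff T i\<bar> * fact i)"
  have B2: "0 \<le> B2" by (simp add: B2_def sum_nonneg)
  obtain b C where b: "0 < b" and C: "0 \<le> C" "\<And>\<omega> P x. \<lbrakk>0 < \<omega>; \<omega> \<le> 1; degree P \<le> n;
     jet N P = fact N; (\<Sum>i\<le>2*n. \<bar>jet i P\<bar>) \<le> (B1 + B2) * \<omega>; \<bar>x\<bar> \<le> 1\<rbrakk> \<Longrightarrow>
     \<bar>cmod (poly P (of_real (\<omega> * x))) - b\<bar> \<le> C * \<omega> \<and>
        \<bar>residual P (\<omega> * x) / \<omega> ^ N - (\<Sum>i\<le>N. jet i P / fact i * (\<omega> * x) ^ i) / \<omega> ^ N\<bar> \<le> C * \<omega>"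
    using close_to_pade[of n] unfolding N_def by blast
  obtain K where K: "0 \<le> K" "\<And>M \<epsilon> x. \<lbrakk>0 \<le> \<epsilon>; degree M \<le> N; coeff M N = 1;
      \<And>x. \<bar>x\<bar> \<le> 1 \<Longrightarrow> \<bar>poly M x\<bar> \<le> \<mu> + \<epsilon>; \<bar>x\<bar> \<le> 1\<rbrakk> \<Longrightarrow> \<bar>poly M x - poly T x\<bar> \<le> K * \<epsilon>"
    using monic_near_minimal[of N] unfolding T_def \<mu>_def by (auto simp: N_def)
  \<comment> \<open>The excess of the norm of the monic polynomial over the minimum \<open>\<mu>\<close>, as it comes out of the comparison.\<close>
  define E where "E \<omega> = (\<mu> + C * \<omega>) * (b + C * \<omega>) / (b - C * \<omega>) + C * \<omega> - \<mu>" for \<omega>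
  have "((\<lambda>\<omega>. C * \<omega> + K * E \<omega>) \<longlongrightarrow> C * 0 + K * ((\<mu> + C * 0) * (b + C * 0) / (b - C * 0) + C * 0 - \<mu>))
      (at_right 0)"
    unfolding E_def using b by (intro tendsto_intros) auto
  then have "((\<lambda>\<omega>. C * \<omega> + K * E \<omega>) \<longlongrightarrow> 0) (at_right 0)" using b by simp
  then have "\<forall>\<^sub>F \<omega> in at_right 0. C * \<omega> + K * E \<omega> < \<epsilon>" using \<epsilon> by (rule order_tendstoD)
  moreover have "((\<lambda>\<omega>. C * \<omega>) \<longlongrightarrow> C * 0) (at_right 0)" by (intro tendsto_intros)
  then have "\<forall>\<^sub>F \<omega> in at_right 0. C * \<omega> < b" using b by (intro order_tendstoD(2)) auto
  moreover have "\<forall>\<^sub>F \<omega> in at_right 0. \<omega> < min 1 \<delta>"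
    using B1(2) by (intro order_tendstoD(2)[OF tendsto_ident_at]) auto
  moreover have "\<forall>\<^sub>F \<omega> in at_right (0::real). 0 < \<omega>" by (simp add: eventually_at_right_less)
  ultimately show ?thesis
    unfolding N_def[symmetric] T_def[symmetric]
  proof eventually_elim
    case (elim \<omega>)
    have \<omega>: "0 < \<omega>" "\<omega> \<le> 1" "\<omega> < \<delta>" "C * \<omega> < b" using elim by auto
    show ?case
    proof (intro allI impI)
      fix r x assume best: "best_approx n \<omega> r" and nodes: "interpolation_nodes n \<omega> r x"
      have "r \<in> unitary_rat n" using best by (simp add: best_approx_def is_arg_min_def)
      then obtain p where p: "p \<noteq> 0" "degree p \<le> n" "r = Fract (dagger p) p"
        by (auto simp: unitary_rat_def)
      obtain c P where P: "c \<noteq> 0" "degree P \<le> n" "jet N P = fact N"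
        "\<And>x. poly P (of_real (\<omega> * x)) = of_real c * poly p (\<i> * of_real x)"
        "(\<Sum>i\<le>2*n. \<bar>jet i P\<bar>) \<le> B1 * \<omega>"
        using B1(3)[of \<omega> p x] \<omega> p nodes by auto
      have P_jets: "(\<Sum>i\<le>2*n. \<bar>jet i P\<bar>) \<le> (B1 + B2) * \<omega>"
        using P(5) B2 \<omega>(1) by (simp add: distrib_right add_increasing2)
      note CP = C(2)[OF \<omega>(1,2) P(2,3) P_jets]
      have P_nz: "poly P (of_real (\<omega> * t)) \<noteq> 0" if "\<bar>t\<bar> \<le> 1" for t
        using CP[OF that] \<omega>(4) by auto
      obtain g where g: "phase_function \<omega> r g" "x ` {1..N} = {t \<in> {-1..1}. g t - \<omega> * t = 0}"
        using nodes by (auto simp: interpolation_nodes_def N_def)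
      have err: "cmod (rat_eval r (\<i> * of_real t) - exp (\<i> * of_real (\<omega> * t)))
          = 2 * \<bar>residual P (\<omega> * t)\<bar> / cmod (poly P (of_real (\<omega> * t)))" if "\<bar>t\<bar> \<le> 1" for t
        unfolding p(3) using P(1,4) P_nz[OF that] by (rule error_eq_residual)

      \<comment> \<open>The competitor: its jets are chosen so that the normalised Taylor polynomial becomes \<open>T\<close>.\<close>
      obtain U where U: "degree U \<le> n" "\<And>i. i \<le> N \<Longrightarrow> jet i U = coeff T i * fact i * \<omega> ^ (N - i)"
        using ex_poly_with_jets[of n "\<lambda>i. coeff T i * fact i * \<omega> ^ (N - i)"] unfolding N_def by blast
      have U_N: "jet N U = fact N" using U(2)[of N] coeff_monic_cheb[of N] by (simp add: T_def N_def)
      have "(\<Sum>i\<le>2*n. \<bar>jet i U\<bar>) \<le> (\<Sum>i\<le>2*n. \<bar>coeff T i\<bar> * fact i * \<omega>)"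
      proof (rule sum_mono)
        fix i assume "i \<in> {..2*n}"
        then have i: "i \<le> N" "1 \<le> N - i" by (auto simp: N_def)
        have "\<omega> ^ (N - i) \<le> \<omega> ^ 1" using \<omega> i(2) by (intro power_decreasing) auto
        then show "\<bar>jet i U\<bar> \<le> \<bar>coeff T i\<bar> * fact i * \<omega>"
          using \<omega>(1) by (simp add: U(2)[OF i(1)] abs_mult mult_left_mono)
      qed
      also have "\<dots> \<le> (B1 + B2) * \<omega>"
        using B1(1) \<omega>(1) by (simp add: B2_def sum_distrib_right distrib_right)
      finally have U_jets: "(\<Sum>i\<le>2*n. \<bar>jet i U\<bar>) \<le> (B1 + B2) * \<omega>" .
      note CU = C(2)[OF \<omega>(1,2) U(1) U_N U_jets]
      have U_nz: "poly U (of_real (\<omega> * t)) \<noteq> 0" if "\<bar>t\<bar> \<le> 1" for t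
        using CU[OF that] \<omega>(4) by auto
      have U_T: "(\<Sum>i\<le>N. jet i U / fact i * (\<omega> * t) ^ i) / \<omega> ^ N = poly T t" for t
      proof -
        have "jet i U / fact i * (\<omega> * t) ^ i = \<omega> ^ N * (coeff T i * t ^ i)" if "i \<le> N" for i
        proof -
          have "\<omega> ^ N = \<omega> ^ (N - i) * \<omega> ^ i" using that by (simp flip: power_add)
          then show ?thesis by (simp add: U(2)[OF that] power_mult_distrib)
        qed
        then have "(\<Sum>i\<le>N. jet i U / fact i * (\<omega> * t) ^ i) = \<omega> ^ N * (\<Sum>i\<le>N. coeff T i * t ^ i)"
          by (simp add: sum_distrib_left)
        also have "(\<Sum>i\<le>N. coeff T i * t ^ i) = poly T t"
          unfolding poly_altdef T_def
          by (rule sum.mono_neutral_right) (auto simp: degree_monic_cheb coeff_eq_0 not_le)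
        finally show ?thesis using \<omega>(1) by simp
      qed
      \<comment> \<open>Returning from \<open>t = \<omega> * x\<close> to \<open>z = \<i> * x\<close>.\<close>
      define u where "u = pcompose U [:0, - \<i> * of_real \<omega>:]"
      have u: "poly U (of_real (\<omega> * t)) = of_real 1 * poly u (\<i> * of_real t)" for t
        by (simp add: u_def poly_pcompose mult.commute mult.left_commute)
      have "u \<noteq> 0" using u[of 0] U_nz[of 0] by auto
      moreover have "degree u \<le> n"
        using U(1) \<omega>(1) by (simp add: u_def degree_pcompose)
      ultimately have u_in: "Fract (dagger u) u \<in> unitary_rat n" by (auto simp: unitary_rat_def)
      have "approx_error \<omega> (Fract (dagger u) u) \<le> 2 * (\<omega> ^ N * (\<mu> + C * \<omega>)) / (b - C * \<omega>)"
        unfolding approx_error_def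
      proof (rule cSUP_least)
        fix t :: real assume "t \<in> {-1..1}"
        then have t: "\<bar>t\<bar> \<le> 1" by auto
        have "\<bar>residual U (\<omega> * t) / \<omega> ^ N\<bar> \<le> \<mu> + C * \<omega>"
          using CU[OF t] abs_poly_monic_cheb_le[OF t, of N] unfolding U_T T_def \<mu>_def by linarith
        then have "\<bar>residual U (\<omega> * t)\<bar> \<le> \<omega> ^ N * (\<mu> + C * \<omega>)"
          using \<omega>(1) by (simp add: abs_divide field_simps)
        moreover have "b - C * \<omega> \<le> cmod (poly U (of_real (\<omega> * t)))" using CU[OF t] by linarith
        ultimately show "cmod (rat_eval (Fract (dagger u) u) (\<i> * of_real t) - exp (\<i> * of_real (\<omega> * t)))
            \<le> 2 * (\<omega> ^ N * (\<mu> + C * \<omega>)) / (b - C * \<omega>)"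
          unfolding error_eq_residual[OF one_neq_zero u U_nz[OF t]]
          using \<omega>(4) by (intro frac_le) auto
      qed simp
      moreover have "approx_error \<omega> r \<le> approx_error \<omega> (Fract (dagger u) u)"
        using best u_in by (auto simp: best_approx_def is_arg_min_def not_less)
      ultimately have le: "approx_error \<omega> r \<le> 2 * (\<omega> ^ N * (\<mu> + C * \<omega>)) / (b - C * \<omega>)" by linarith

      obtain M where M: "degree M \<le> N" "coeff M N = 1"
        "\<And>x. poly M x = (\<Sum>i\<le>N. jet i P / fact i * (\<omega> * x) ^ i) / \<omega> ^ N"
        using sum_jets_eq_monic_poly[of "\<lambda>i. jet i P" N \<omega>] P(3) \<omega>(1) by auto
      \<comment> \<open>Optimality, read as a bound for the monic polynomial \<open>M\<close> attached to the best approximation.\<close>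
      have M_le: "\<bar>poly M t\<bar> \<le> \<mu> + E \<omega>" if t: "\<bar>t\<bar> \<le> 1" for t
      proof -
        have "2 * \<bar>residual P (\<omega> * t)\<bar> / cmod (poly P (of_real (\<omega> * t)))
            \<le> 2 * (\<omega> ^ N * (\<mu> + C * \<omega>)) / (b - C * \<omega>)"
          using error_le_approx_error[OF g(1) t] le unfolding err[OF t] by linarith
        then have "2 * \<bar>residual P (\<omega> * t)\<bar>
            \<le> 2 * (\<omega> ^ N * (\<mu> + C * \<omega>)) / (b - C * \<omega>) * cmod (poly P (of_real (\<omega> * t)))"
          using P_nz[OF t] by (simp add: pos_divide_le_eq)
        also have "\<dots> \<le> 2 * (\<omega> ^ N * (\<mu> + C * \<omega>)) / (b - C * \<omega>) * (b + C * \<omega>)"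
        proof (rule mult_left_mono)
          show "cmod (poly P (of_real (\<omega> * t))) \<le> b + C * \<omega>" using CP[OF t] by linarith
        qed (use \<omega> \<mu> C(1) in auto)
        finally have "\<bar>residual P (\<omega> * t) / \<omega> ^ N\<bar> \<le> (\<mu> + C * \<omega>) * (b + C * \<omega>) / (b - C * \<omega>)"
          using \<omega>(1) by (simp add: abs_divide pos_divide_le_eq mult_ac)
        then show ?thesis
          using CP[OF t] unfolding M(3)[symmetric] E_def by linarith
      qed
      have "\<mu> * (b - C * \<omega>) \<le> (\<mu> + C * \<omega>) * (b + C * \<omega>)"
        using \<mu> C(1) \<omega> by (intro mult_mono) auto
      then have "\<mu> \<le> (\<mu> + C * \<omega>) * (b + C * \<omega>) / (b - C * \<omega>)"
        using \<omega>(4) by (simp add: pos_le_divide_eq)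
      moreover have "0 \<le> C * \<omega>" using C(1) \<omega>(1) by simp
      ultimately have "0 \<le> E \<omega>" unfolding E_def by linarith
      then have "\<bar>poly M t - poly T t\<bar> \<le> K * E \<omega>" if "\<bar>t\<bar> \<le> 1" for t
        using K(2) M(1,2) M_le that by blast
      then have "\<bar>residual P (\<omega> * t) / \<omega> ^ N - poly T t\<bar> < \<epsilon>" if "\<bar>t\<bar> \<le> 1" for t
        using CP[OF that] elim(1) that unfolding M(3)[symmetric] by fastforce
      moreover have "t \<in> x ` {1..N}" if t: "\<bar>t\<bar> \<le> 1" "residual P (\<omega> * t) = 0" for t
      proof -
        have "t \<in> {-1..1}" using t(1) by auto
        moreover have "rat_eval r (\<i> * of_real t) = exp (\<i> * of_real (\<omega> * t))"
          using err[OF t(1)] t(2) by simp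
        ultimately show ?thesis unfolding g(2) using phase_function_node_iff[OF g(1)] by auto
      qed
      ultimately show "\<exists>P. \<forall>t. \<bar>t\<bar> \<le> 1 \<longrightarrow> (residual P (\<omega> * t) = 0 \<longrightarrow> t \<in> x ` {1..N}) \<and>
          \<bar>residual P (\<omega> * t) / \<omega> ^ N - poly T t\<bar> < \<epsilon>" by blast
    qed
  qed
qed

section \<open>From the residual to its zeros\<close>

lemma strict_mono_on_eq_of_image_eq:
  fixes x y :: "nat \<Rightarrow> real"
  assumes "strict_mono_on {1..N} x" "strict_mono_on {1..N} y" "x ` {1..N} = y ` {1..N}"
  shows "i \<in> {1..N} \<Longrightarrow> x i = y i"
proof (induction i rule: less_induct)
  case (less i)
  have le: "u i \<le> v i" if uv: "strict_mono_on {1..N} u" "strict_mono_on {1..N} v"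
    "u ` {1..N} = v ` {1..N}" "\<And>k. k < i \<Longrightarrow> k \<in> {1..N} \<Longrightarrow> u k = v k" for u v :: "nat \<Rightarrow> real"
  proof -
    obtain k where k: "k \<in> {1..N}" "v i = u k" using uv(3) less.prems by blast
    have "\<not> k < i"
      using k uv(4)[of k] strict_mono_onD[OF uv(2), of k i] less.prems by auto
    then show ?thesis
      using k less.prems strict_mono_onD[OF uv(1), of i k] by (cases "i = k") auto
  qed
  show ?case
    using le[of x y] le[of y x] assms less.IH by (intro antisym) auto
qed

lemma abs_cos_diff_le: "\<bar>cos a - cos b\<bar> \<le> \<bar>a - b\<bar>" for a b :: real
proof -
  have "\<bar>cos a - cos b\<bar> = 2 * (\<bar>sin ((a + b) / 2)\<bar> * \<bar>sin ((b - a) / 2)\<bar>)"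
    unfolding cos_diff_cos by (simp add: abs_mult)
  also have "\<dots> \<le> 2 * (1 * \<bar>(b - a) / 2\<bar>)"
    by (intro mult_left_mono mult_mono abs_sin_x_le_abs_x) auto
  finally show ?thesis by simp
qed

text \<open>In the angle variable the Chebyshev polynomial has the same modulus at both endpoints at distance
\<open>\<eta>\<close> from each node, and opposite signs. This makes the admissible perturbation the
same for all nodes.\<close>
lemma zeros_near_chebyshev_nodes:
  fixes f :: "real \<Rightarrow> real"
  assumes "continuous_on UNIV f" and \<eta>: "0 < \<eta>" "\<eta> < pi / (2 * real N)" and j: "j \<in> {1..N}"
    and near: "\<And>t. \<bar>t\<bar> \<le> 1 \<Longrightarrow> \<bar>f t - poly (monic_cheb N) t\<bar> < sin (real N * \<eta>) / 2 ^ (N - 1)"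
  defines "\<theta> \<equiv> (2 * real j - 1) * pi / (2 * real N)"
  shows "\<exists>z. cos (\<theta> + \<eta>) < z \<and> z < cos (\<theta> - \<eta>) \<and> f z = 0"
proof -
  have N: "0 < real N" using j by auto
  have N\<theta>: "real N * \<theta> = real j * pi - pi / 2"
    using N by (simp add: \<theta>_def field_simps)
  have cos_N\<theta>: "cos (real N * \<theta>) = 0" and sin_N\<theta>: "sin (real N * \<theta>) = - ((-1) ^ j)"
    unfolding N\<theta> by (simp_all add: cos_diff sin_diff)
  have "cos (real N * (\<theta> + \<eta>)) = (-1) ^ j * sin (real N * \<eta>)"
    "cos (real N * (\<theta> - \<eta>)) = - ((-1) ^ j * sin (real N * \<eta>))"
    unfolding distrib_left right_diff_distrib cos_add cos_diff cos_N\<theta> sin_N\<theta> by simp_all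
  then have "poly (monic_cheb N) (cos (\<theta> + \<eta>)) = (-1) ^ j * (sin (real N * \<eta>) / 2 ^ (N - 1))"
    "poly (monic_cheb N) (cos (\<theta> - \<eta>)) = - ((-1) ^ j * (sin (real N * \<eta>) / 2 ^ (N - 1)))"
    by (simp_all add: poly_monic_cheb_cos)
  moreover have "(-1::real) ^ j = 1 \<or> (-1::real) ^ j = -1" by (cases "even j") auto
  ultimately have sgn: "0 < (-1) ^ j * f (cos (\<theta> + \<eta>))" "(-1) ^ j * f (cos (\<theta> - \<eta>)) < 0"
    using near[of "cos (\<theta> + \<eta>)"] near[of "cos (\<theta> - \<eta>)"] by auto
  have "0 \<le> \<theta> - \<eta>"
  proof -
    have "1 * pi / (2 * real N) \<le> \<theta>"
      unfolding \<theta>_def using j N by (intro divide_right_mono mult_right_mono) auto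
    then show ?thesis using \<eta>(2) by simp
  qed
  moreover have "\<theta> + \<eta> \<le> pi"
  proof -
    have "\<theta> + \<eta> \<le> \<theta> + pi / (2 * real N)" using \<eta>(2) by simp
    also have "\<dots> = real j / real N * pi" using N by (simp add: \<theta>_def field_simps)
    also have "\<dots> \<le> 1 * pi" using j N by (intro mult_right_mono) auto
    finally show ?thesis by simp
  qed
  ultimately have less: "cos (\<theta> + \<eta>) < cos (\<theta> - \<eta>)"
    using \<eta>(1) by (intro cos_monotone_0_pi) auto
  have "continuous_on {cos (\<theta> + \<eta>)..cos (\<theta> - \<eta>)} (\<lambda>t. (-1) ^ j * f t)"
    using assms(1) by (intro continuous_intros) (auto intro: continuous_on_subset)
  then obtain z where z: "cos (\<theta> + \<eta>) \<le> z" "z \<le> cos (\<theta> - \<eta>)" "(-1) ^ j * f z = 0"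
    using IVT2'[of "\<lambda>t. (-1) ^ j * f t" "cos (\<theta> - \<eta>)" 0 "cos (\<theta> + \<eta>)"] sgn less by auto
  then have "f z = 0" by simp
  moreover from this have "z \<noteq> cos (\<theta> + \<eta>)" "z \<noteq> cos (\<theta> - \<eta>)" using sgn by auto
  ultimately show ?thesis using z by (intro exI[of _ z]) auto
qed

text \<open>The intervals around different Chebyshev nodes are disjoint, so they provide \<open>N\<close> zeros; as there
are only \<open>N\<close> nodes, these are all of them, and the order decides which is which. The
Chebyshev nodes decrease with their index, whence the reversal.\<close>
lemma nodes_near_chebyshev_nodes:
  fixes f :: "real \<Rightarrow> real" and x :: "nat \<Rightarrow> real"
  assumes f: "continuous_on UNIV f" and \<eta>: "0 < \<eta>" "\<eta> < pi / (2 * real N)"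
    and near: "\<And>t. \<bar>t\<bar> \<le> 1 \<Longrightarrow> \<bar>f t - poly (monic_cheb N) t\<bar> < sin (real N * \<eta>) / 2 ^ (N - 1)"
    and x: "strict_mono_on {1..N} x" "\<And>t. \<bar>t\<bar> \<le> 1 \<Longrightarrow> f t = 0 \<Longrightarrow> t \<in> x ` {1..N}"
    and j: "j \<in> {1..N}"
  shows "\<bar>x (N + 1 - j) - cos ((2 * real j - 1) * pi / (2 * real N))\<bar> \<le> \<eta>"
proof -
  define \<theta> where "\<theta> k = (2 * real k - 1) * pi / (2 * real N)" for k
  have "\<forall>k\<in>{1..N}. \<exists>z. cos (\<theta> k + \<eta>) < z \<and> z < cos (\<theta> k - \<eta>) \<and> f z = 0"
    unfolding \<theta>_def using zeros_near_chebyshev_nodes[OF f \<eta> _ near] by blast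
  then obtain z where z: "\<And>k. k \<in> {1..N} \<Longrightarrow> cos (\<theta> k + \<eta>) < z k \<and> z k < cos (\<theta> k - \<eta>) \<and> f (z k) = 0"
    by metis
  have z_less: "z l < z k" if "k \<in> {1..N}" "l \<in> {1..N}" "k < l" for k l
  proof -
    have N: "0 < real N" using that by auto
    have "1 * (pi / real N) \<le> real (l - k) * (pi / real N)"
      using that N by (intro mult_right_mono) auto
    also have "\<dots> = \<theta> l - \<theta> k" using that N by (simp add: \<theta>_def of_nat_diff field_simps)
    finally have "\<theta> k + \<eta> \<le> \<theta> l - \<eta>" using \<eta>(2) by simp
    moreover have "0 \<le> \<theta> k + \<eta>" using that \<eta>(1) N by (simp add: \<theta>_def)
    moreover have "\<theta> l - \<eta> \<le> pi"
    proof -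
      have "\<theta> l \<le> 2 * real N * pi / (2 * real N)"
        unfolding \<theta>_def using that N by (intro divide_right_mono mult_right_mono) auto
      then show ?thesis using N \<eta>(1) by simp
    qed
    ultimately have "cos (\<theta> l - \<eta>) \<le> cos (\<theta> k + \<eta>)"
      by (intro cos_monotone_0_pi_le) auto
    then show ?thesis using z[OF that(1)] z[OF that(2)] by linarith
  qed
  define y where "y i = z (N + 1 - i)" for i
  have y_mono: "strict_mono_on {1..N} y"
    by (intro strict_mono_onI) (auto simp: y_def intro!: z_less)
  have "y ` {1..N} \<subseteq> x ` {1..N}"
  proof
    fix t assume "t \<in> y ` {1..N}"
    then obtain i where "i \<in> {1..N}" "t = z (N + 1 - i)" by (auto simp: y_def)
    then obtain k where k: "k \<in> {1..N}" "t = z k" by (intro that[of "N + 1 - i"]) auto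
    have "\<bar>t\<bar> \<le> 1"
      using z[OF k(1)] cos_ge_minus_one[of "\<theta> k + \<eta>"] cos_le_one[of "\<theta> k - \<eta>"]
      unfolding k(2) abs_le_iff by linarith
    then show "t \<in> x ` {1..N}" using x(2) z[OF k(1)] k(2) by blast
  qed
  moreover have "card (y ` {1..N}) = card (x ` {1..N})"
    using strict_mono_on_imp_inj_on[OF y_mono] strict_mono_on_imp_inj_on[OF x(1)]
    by (simp add: card_image)
  ultimately have "x ` {1..N} = y ` {1..N}"
    by (metis card_subset_eq finite_imageI finite_atLeastAtMost)
  then have "x (N + 1 - j) = y (N + 1 - j)"
    by (rule strict_mono_on_eq_of_image_eq[OF x(1) y_mono]) (use j in auto)
  also have "\<dots> = z j" using j by (simp add: y_def)
  finally have "x (N + 1 - j) = z j" .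
  moreover have "\<bar>cos (\<theta> j + \<eta>) - cos (\<theta> j)\<bar> \<le> \<eta>" "\<bar>cos (\<theta> j - \<eta>) - cos (\<theta> j)\<bar> \<le> \<eta>"
    using abs_cos_diff_le[of "\<theta> j + \<eta>" "\<theta> j"] abs_cos_diff_le[of "\<theta> j - \<eta>" "\<theta> j"] \<eta>(1) by auto
  ultimately show ?thesis using z[OF j] unfolding \<theta>_def[symmetric] by linarith
qed

theorem proposition9p3:
  fixes n :: nat
    and r :: "real \<Rightarrow> complex poly fract"
    and x :: "real \<Rightarrow> nat \<Rightarrow> real"
  assumes "n \<ge> 1"
    and "\<And>\<omega>. \<omega> \<in> {0<..<(real n + 1) * pi} \<Longrightarrow> best_approx n \<omega> (r \<omega>)"
    and "\<And>\<omega>. \<omega> \<in> {0<..<(real n + 1) * pi} \<Longrightarrow> interpolation_nodes n \<omega> (r \<omega>) (x \<omega>)"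
  shows "\<forall>j\<in>{1..2 * n + 1}.
           ((\<lambda>\<omega>. x \<omega> (2 * n + 2 - j)) \<longlongrightarrow> chebyshev_node n j) (at_right 0)"
proof (intro ballI tendstoI)
  fix j and e :: real assume j: "j \<in> {1..2 * n + 1}" and e: "0 < e"
  define N where "N = 2 * n + 1"
  have N: "0 < N" by (simp add: N_def)
  define \<eta> where "\<eta> = min (e / 2) (pi / (4 * real N))"
  have \<eta>: "0 < \<eta>" "\<eta> < e" "\<eta> < pi / (2 * real N)"
    using e N by (auto simp: \<eta>_def min_less_iff_disj field_simps)
  have "real N * \<eta> < pi / 2" using \<eta>(3) N by (simp add: field_simps)
  then have "real N * \<eta> < pi" using pi_gt_zero by linarith
  then have "0 < sin (real N * \<eta>) / 2 ^ (N - 1)" using N \<eta>(1) by (simp add: sin_gt_zero)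
  then have "\<forall>\<^sub>F \<omega> in at_right 0. \<forall>r x. best_approx n \<omega> r \<longrightarrow> interpolation_nodes n \<omega> r x \<longrightarrow>
    (\<exists>P. \<forall>t. \<bar>t\<bar> \<le> 1 \<longrightarrow> (residual P (\<omega> * t) = 0 \<longrightarrow> t \<in> x ` {1..N}) \<and>
      \<bar>residual P (\<omega> * t) / \<omega> ^ N - poly (monic_cheb N) t\<bar> < sin (real N * \<eta>) / 2 ^ (N - 1))"
    unfolding N_def by (rule best_residual_near_chebyshev)
  moreover have "\<forall>\<^sub>F \<omega> in at_right 0. \<omega> \<in> {0<..<(real n + 1) * pi}"
    by (intro eventually_at_right_real) simp
  ultimately show "\<forall>\<^sub>F \<omega> in at_right 0. dist (x \<omega> (2 * n + 2 - j)) (chebyshev_node n j) < e"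
  proof eventually_elim
    case (elim \<omega>)
    have nodes: "interpolation_nodes n \<omega> (r \<omega>) (x \<omega>)" using assms(3) elim(2) .
    obtain P where P: "\<And>t. \<bar>t\<bar> \<le> 1 \<Longrightarrow> residual P (\<omega> * t) = 0 \<Longrightarrow> t \<in> x \<omega> ` {1..N}"
      "\<And>t. \<bar>t\<bar> \<le> 1 \<Longrightarrow>
        \<bar>residual P (\<omega> * t) / \<omega> ^ N - poly (monic_cheb N) t\<bar> < sin (real N * \<eta>) / 2 ^ (N - 1)"
      using elim(1) assms(2)[OF elim(2)] nodes by blast
    have "continuous_on UNIV (residual P)"
      by (intro continuous_at_imp_continuous_on ballI DERIV_isCont[OF DERIV_residual])
    then have "continuous_on UNIV (\<lambda>t. residual P (\<omega> * t) / \<omega> ^ N)"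
      using elim(2)
      by (intro continuous_on_divide continuous_on_compose2[of UNIV "residual P" UNIV "\<lambda>t. \<omega> * t"])
        (auto intro!: continuous_intros)
    moreover have "strict_mono_on {1..N} (x \<omega>)"
      using nodes by (auto simp: interpolation_nodes_def N_def)
    moreover have "residual P (\<omega> * t) / \<omega> ^ N = 0 \<longleftrightarrow> residual P (\<omega> * t) = 0" for t
      using elim(2) by simp
    ultimately have "\<bar>x \<omega> (N + 1 - j) - cos ((2 * real j - 1) * pi / (2 * real N))\<bar> \<le> \<eta>"
      using nodes_near_chebyshev_nodes[of "\<lambda>t. residual P (\<omega> * t) / \<omega> ^ N" \<eta> N "x \<omega>" j] \<eta> P j
      by (simp add: N_def)
    then show ?case
      using \<eta>(2) by (simp add: dist_real_def chebyshev_node_def N_def algebra_simps)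
  qed
qed

end
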